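(* Let $\mathcal G$ be a metric graph satisfying the growth condition (stated in the context), and let $m\ge1$. The semigroup $(T(t))_{t\ge0}$ generated by $-(-\Delta_X)^m$ is never uniformly stable on any of the spaces $X=L^p(\mathcal G)$ ($p\in[1,\infty)$), $C_0(\mathcal G)$, $BUC(\mathcal G)$; that is, $\|T(t)\|_{\mathcal L(X)}\to0$ as $t\to\infty$ does not hold.
   Context: **Metric graph.** $\mathcal G$ is the metric graph over a countable, oriented, connected graph with vertex set $\mathcal V$ and edge set $\mathcal E$, without self-loops, uniformly locally finite: writing $\mathcal E_{\mathsf v}$ for the set of edges incident to $\mathsf v$, $\sup_{\mathsf v}|\mathcal E_{\mathsf v}|<\infty$. Every edge $\mathsf e$ has an initial vertex $i(\mathsf e)$, a terminal vertex $t(\mathsf e)$ and a length with $0<\ell_\downarrow\le|\mathsf e|\le\ell_\uparrow<\infty$, and is identified with $(0,|\mathsf e|)$ ($0\leftrightarrow i(\mathsf e)$, $|\mathsf e|\leftrightarrow t(\mathsf e)$). $\mathcal G$ carries the natural path metric. Each edge has a conductivity $c(\mathsf e)>0$. **Growth condition.** There are constants $k_\downarrow,k_\uparrow$ (with $k_\downarrow>0$) such that $k_\downarrow\le c(\mathsf e)\le k_\uparrow$ for all edges, and the number of edges grows sub-exponentially: if $k(r)$ is the number of edges contained in the ball of radius $r$ around a fixed reference vertex, then for all $\varepsilon>0$, $k(r)e^{-\varepsilon r}\to0$ as $r\to\infty$. **Spaces and operators.** $L^p(\mathcal G)$ is taken with respect to the measure whose restriction to $\mathsf e$ is $c(\mathsf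 e)$ times Lebesgue measure; $C_0(\mathcal G)$ (continuous functions vanishing at infinity) and $BUC(\mathcal G)$ (bounded uniformly continuous functions) carry the sup-norm. Normal derivative: $\frac{\partial u_{\mathsf e}}{\partial n_{\mathsf e}}(\mathsf v)=c(\mathsf e)u'_{\mathsf e}(0^+)$ if $\mathsf v=i(\mathsf e)$, and $-c(\mathsf e)u'_{\mathsf e}(|\mathsf e|^-)$ if $\mathsf v=t(\mathsf e)$. Kirchhoff condition: $\sum_{\mathsf e\in\mathcal E_{\mathsf v}}\frac{\partial u_{\mathsf e}}{\partial n_{\mathsf e}}(\mathsf v)=0$ for all $\mathsf v\in\mathcal V$. $(\Delta_Xu)_{\mathsf e}=u''_{\mathsf e}$ with $D(\Delta_X)=\{u\in X:(u''_{\mathsf e})_{\mathsf e}\in X,\ u\in C(\mathcal G),\ u\text{ satisfies the Kirchhoff condition}\}$ ($C(\mathcal G)$: continuous, in particular at vertices), and $D(\Delta_X^{m+1})=\{u\in D(\Delta_X^m):\Delta_X^mu\in D(\Delta_X)\}$. *)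

theory Defs
  imports "HOL-Analysis.Analysis" "Graph_Theory.Digraph_Component"
begin

section \<open>Metric graphs\<close>

text \<open>
  The oriented graph is a \<^typ>\<open>('v, 'e) pre_digraph\<close>: the edge \<open>e\<close> has initial vertex
  \<open>tail (skel G) e\<close> and terminal vertex \<open>head (skel G) e\<close>. Parallel edges are allowed.
\<close>

record ('v, 'e) mgraph =
  skel :: "('v, 'e) pre_digraph"
  len :: "'e \<Rightarrow> real"
  cond :: "'e \<Rightarrow> real"

definition incident :: "('v, 'e) mgraph \<Rightarrow> 'v \<Rightarrow> 'e set" where
  "incident G v = {e \<in> arcs (skel G). tail (skel G) e = v \<or> head (skel G) e = v}"

text \<open>
  At least one edge is required: on a single vertex without edges all the spaces \<open>L\<^sup>p\<close> are zero.
\<close>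

locale metric_graph = loopfree_digraph "skel G" for G :: "('v, 'e) mgraph" +
  assumes countable_verts: "countable (verts (skel G))"
    and countable_arcs: "countable (arcs (skel G))"
    and has_edge: "arcs (skel G) \<noteq> {}"
    and connected_skel: "Digraph_Component.connected (skel G)"
    and locally_finite: "\<exists>K. \<forall>v\<in>verts (skel G). finite (incident G v) \<and> card (incident G v) \<le> K"
    and len_bounds: "\<exists>l u. 0 < l \<and> (\<forall>e\<in>arcs (skel G). l \<le> len G e \<and> len G e \<le> u)"
    and cond_pos: "\<And>e. e \<in> arcs (skel G) \<Longrightarrow> 0 < cond G e"

datatype ('v, 'e) gpoint = Vertex 'v | Inner 'e real

definition points :: "('v, 'e) mgraph \<Rightarrow> ('v, 'e) gpoint set" where
  "points G = Vertex ` verts (skel G) \<union> {Inner e x |e x. e \<in> arcs (skel G) \<and> 0 < x \<and> x < len G e}"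

text \<open>The point with coordinate \<open>x\<close> in \<open>[0, len G e]\<close> on the closed edge \<open>e\<close>.\<close>

definition edge_pt :: "('v, 'e) mgraph \<Rightarrow> 'e \<Rightarrow> real \<Rightarrow> ('v, 'e) gpoint" where
  "edge_pt G e x =
    (if x = 0 then Vertex (tail (skel G) e)
     else if x = len G e then Vertex (head (skel G) e)
     else Inner e x)"

text \<open>
  \<open>gpath G p q L\<close>: there is a path of length \<open>L\<close> from \<open>p\<close> to \<open>q\<close>, composed of finitely many
  segments each of which lies in one closed edge.
\<close>

inductive gpath :: "('v, 'e) mgraph \<Rightarrow> ('v, 'e) gpoint \<Rightarrow> ('v, 'e) gpoint \<Rightarrow> real \<Rightarrow> bool"
  for G p where
  refl: "p \<in> points G \<Longrightarrow> gpath G p p 0"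
| step: "gpath G p (edge_pt G e x) L \<Longrightarrow> e \<in> arcs (skel G) \<Longrightarrow> x \<in> {0..len G e} \<Longrightarrow> y \<in> {0..len G e}
    \<Longrightarrow> gpath G p (edge_pt G e y) (L + \<bar>x - y\<bar>)"

definition path_dist :: "('v, 'e) mgraph \<Rightarrow> ('v, 'e) gpoint \<Rightarrow> ('v, 'e) gpoint \<Rightarrow> real" where
  "path_dist G p q =
    (if p \<in> points G \<and> q \<in> points G then Inf {L. gpath G p q L} else 0)"

definition path_metric :: "('v, 'e) mgraph \<Rightarrow> ('v, 'e) gpoint metric" where
  "path_metric G = metric (points G, path_dist G)"

context metric_graph
begin

lemma len_pos: "e \<in> arcs (skel G) \<Longrightarrow> 0 < len G e"
  using len_bounds by force

lemma edge_pt_in_points: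
  "e \<in> arcs (skel G) \<Longrightarrow> x \<in> {0..len G e} \<Longrightarrow> edge_pt G e x \<in> points G"
  by (auto simp: edge_pt_def points_def)

lemma gpath_points: "gpath G p q L \<Longrightarrow> p \<in> points G \<and> q \<in> points G"
  by (induction rule: gpath.induct) (auto intro: edge_pt_in_points)

lemma gpath_nonneg: "gpath G p q L \<Longrightarrow> 0 \<le> L"
  by (induction rule: gpath.induct) auto

lemma gpath_trans: "gpath G q r M \<Longrightarrow> gpath G p q L \<Longrightarrow> gpath G p r (L + M)"
proof (induction rule: gpath.induct)
  case refl
  then show ?case by simp
next
  case (step e x M y)
  then show ?case using gpath.step[of G p e x "L + M" y] by (simp add: add.assoc)
qed

lemma gpath_edge:
  assumes "e \<in> arcs (skel G)" "x \<in> {0..len G e}" "y \<in> {0..len G e}"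
  shows "gpath G (edge_pt G e x) (edge_pt G e y) \<bar>x - y\<bar>"
  using gpath.step[OF gpath.refl[OF edge_pt_in_points[OF assms(1,2)]] assms(1,2,3)] by simp

lemma gpath_sym: "gpath G p q L \<Longrightarrow> gpath G q p L"
proof (induction rule: gpath.induct)
  case refl
  then show ?case by (rule gpath.refl)
next
  case (step e x L y)
  have *: "gpath G (edge_pt G e y) (edge_pt G e x) \<bar>x - y\<bar>"
    using gpath_edge[OF step(2) step(4) step(3)] by (simp add: abs_minus_commute)
  show ?case using gpath_trans[OF step.IH *] by (simp add: add.commute)
qed

lemma gpath_arc:
  assumes "e \<in> arcs (skel G)"
  shows "\<exists>L. gpath G (Vertex (tail (skel G) e)) (Vertex (head (skel G) e)) L"
proof -
  have "gpath G (edge_pt G e 0) (edge_pt G e (len G e)) \<bar>0 - len G e\<bar>"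
    using len_pos[OF assms] by (intro gpath_edge[OF assms]) auto
  then show ?thesis using len_pos[OF assms] by (auto simp: edge_pt_def)
qed

lemma gpath_vertices:
  assumes "v \<in> verts (skel G)" "w \<in> verts (skel G)"
  shows "\<exists>L. gpath G (Vertex v) (Vertex w) L"
proof -
  have "v \<rightarrow>\<^sup>*\<^bsub>mk_symmetric (skel G)\<^esub> w"
    using connected_skel assms unfolding Digraph_Component.connected_def by auto
  then have "(v, w) \<in> rtrancl_on (verts (skel G)) (parcs (mk_symmetric (skel G)))"
    unfolding reachable_def by simp
  then show ?thesis
  proof (induction rule: rtrancl_on.induct)
    case rtrancl_on_refl
    then show ?case
      using assms by (intro exI[of _ 0] gpath.refl) (auto simp: points_def)
  next
    case (rtrancl_on_into_rtrancl_on u y z)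
    then obtain e where e: "e \<in> arcs (skel G)"
      "(y = tail (skel G) e \<and> z = head (skel G) e) \<or> (y = head (skel G) e \<and> z = tail (skel G) e)"
      by (auto simp: parcs_mk_symmetric)
    then obtain L where "gpath G (Vertex y) (Vertex z) L"
      using gpath_arc[OF e(1)] gpath_sym by blast
    with rtrancl_on_into_rtrancl_on show ?case using gpath_trans by blast
  qed
qed

lemma gpath_to_vertex:
  assumes "p \<in> points G"
  shows "\<exists>v L. v \<in> verts (skel G) \<and> gpath G p (Vertex v) L"
proof -
  consider v where "p = Vertex v" "v \<in> verts (skel G)"
    | e x where "p = Inner e x" "e \<in> arcs (skel G)" "0 < x" "x < len G e"
    using assms by (auto simp: points_def)
  then show ?thesis
  proof cases
    case 1
    then show ?thesis using assms gpath.refl by blast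
  next
    case 2
    then have "gpath G (edge_pt G e x) (edge_pt G e 0) \<bar>x - 0\<bar>"
      by (intro gpath_edge) auto
    with 2 show ?thesis using tail_in_verts by (auto simp: edge_pt_def intro: exI[of _ "tail (skel G) e"])
  qed
qed

lemma gpath_exists:
  assumes "p \<in> points G" "q \<in> points G"
  shows "\<exists>L. gpath G p q L"
proof -
  obtain v L w M where "v \<in> verts (skel G)" "gpath G p (Vertex v) L"
    "w \<in> verts (skel G)" "gpath G q (Vertex w) M"
    using assms gpath_to_vertex by meson
  then show ?thesis using gpath_vertices gpath_trans gpath_sym by meson
qed

lemma gpath_from_Inner:
  assumes "gpath G (Inner e x) q L" "L < x" "L < len G e - x"
  shows "\<exists>y. q = Inner e y \<and> \<bar>x - y\<bar> \<le> L"
  using assms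
proof (induction rule: gpath.induct)
  case refl
  then show ?case by auto
next
  case (step f s L t)
  have "L < x" "L < len G e - x" using step.prems by auto
  then obtain y where y: "edge_pt G f s = Inner e y" "\<bar>x - y\<bar> \<le> L"
    using step.IH by auto
  then have "f = e" "s = y" by (auto simp: edge_pt_def split: if_splits)
  moreover have "t \<noteq> 0" "t \<noteq> len G e" "\<bar>x - t\<bar> \<le> L + \<bar>s - t\<bar>"
    using y \<open>s = y\<close> step.prems by auto
  ultimately show ?case using y by (auto simp: edge_pt_def)
qed

lemma gpath_from_Vertex:
  assumes "gpath G (Vertex v) q L" "\<forall>e\<in>arcs (skel G). L < len G e"
  shows "q = Vertex v \<or> (\<exists>e y. q = Inner e y)"
proof -
  have "q = Vertex v \<or> (\<exists>e y. q = Inner e y \<and> e \<in> arcs (skel G) \<and>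
     ((tail (skel G) e = v \<and> y \<le> L) \<or> (head (skel G) e = v \<and> len G e - y \<le> L)))"
    using assms
  proof (induction rule: gpath.induct)
    case refl
    then show ?case by auto
  next
    case (step f s L t)
    have L: "\<forall>e\<in>arcs (skel G). L < len G e" using step.prems by force
    have T: "L + \<bar>s - t\<bar> < len G f" using step.prems step.hyps by blast
    have L0: "0 \<le> L" using step.hyps(1) gpath_nonneg by blast
    have "tail (skel G) f = v \<and> s \<le> L \<or> head (skel G) f = v \<and> len G f - s \<le> L"
      using step.IH[OF L] L0 by (auto simp: edge_pt_def split: if_splits)
    then have "tail (skel G) f = v \<and> t \<le> L + \<bar>s - t\<bar>
        \<or> head (skel G) f = v \<and> len G f - t \<le> L + \<bar>s - t\<bar>" by auto
    then show ?case using T step.hyps by (auto simp: edge_pt_def)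
  qed
  then show ?thesis by auto
qed

lemma bdd_below_gpath: "bdd_below {L. gpath G p q L}"
  using gpath_nonneg by (intro bdd_belowI[of _ 0]) auto

lemma path_dist_less:
  assumes "p \<in> points G" "q \<in> points G" "path_dist G p q < r"
  shows "\<exists>L<r. gpath G p q L"
  using assms gpath_exists cInf_less_iff[of "{L. gpath G p q L}" r] bdd_below_gpath
  unfolding path_dist_def by auto

lemma path_dist_le: "gpath G p q L \<Longrightarrow> path_dist G p q \<le> L"
  using bdd_below_gpath gpath_points by (auto simp: path_dist_def intro!: cInf_lower)

lemma path_dist_sym: "path_dist G p q = path_dist G q p"
  unfolding path_dist_def using gpath_sym by (metis (no_types, lifting) Collect_cong)

lemma path_dist_nonneg: "0 \<le> path_dist G p q"
  using gpath_exists[of p q] gpath_nonneg by (auto simp: path_dist_def intro!: cInf_greatest)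

lemma path_dist_0_Inner:
  assumes "Inner e x \<in> points G" "q \<in> points G" "path_dist G (Inner e x) q = 0"
  shows "q = Inner e x"
proof -
  have x: "0 < x" "x < len G e" using assms by (auto simp: points_def)
  have *: "\<exists>y. q = Inner e y \<and> \<bar>x - y\<bar> < r" if r: "0 < r" "r \<le> min x (len G e - x)" for r
  proof -
    obtain L where "L < r" "gpath G (Inner e x) q L" using path_dist_less assms r(1) by metis
    with gpath_from_Inner[OF this(2)] r(2) show ?thesis by auto
  qed
  obtain y where y: "q = Inner e y" using *[of "min x (len G e - x)"] x by auto
  have "x = y"
  proof (rule ccontr)
    assume "x \<noteq> y"
    then have "0 < min \<bar>x - y\<bar> (min x (len G e - x))" using x by simp
    from *[OF this min.cobounded2] y show False by simp
  qed
  with y show ?thesis by simp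
qed

lemma path_dist_0:
  assumes "p \<in> points G" "q \<in> points G" "path_dist G p q = 0"
  shows "p = q"
proof (cases p)
  case (Inner e x)
  then show ?thesis using path_dist_0_Inner assms by auto
next
  case (Vertex v)
  show ?thesis
  proof (cases q)
    case (Inner e x)
    then show ?thesis using path_dist_0_Inner assms path_dist_sym by metis
  next
    case w: (Vertex w)
    obtain l where l: "0 < l" "\<forall>e\<in>arcs (skel G). l \<le> len G e" using len_bounds by blast
    then obtain L where "L < l" "gpath G p q L" using path_dist_less assms by metis
    then show ?thesis using gpath_from_Vertex[of v q L] l Vertex w by force
  qed
qed

lemma path_dist_triangle:
  assumes "p \<in> points G" "q \<in> points G" "r \<in> points G"
  shows "path_dist G p r \<le> path_dist G p q + path_dist G q r"
proof (rule field_le_epsilon)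
  fix \<epsilon> :: real assume "0 < \<epsilon>"
  then obtain L M where "L < path_dist G p q + \<epsilon> / 2" "gpath G p q L"
    "M < path_dist G q r + \<epsilon> / 2" "gpath G q r M"
    using path_dist_less[OF assms(1,2), of "path_dist G p q + \<epsilon> / 2"]
      path_dist_less[OF assms(2,3), of "path_dist G q r + \<epsilon> / 2"] by auto
  then show "path_dist G p r \<le> path_dist G p q + path_dist G q r + \<epsilon>"
    using path_dist_le[OF gpath_trans, of q r M p L] by simp
qed

lemma path_dist_refl: "path_dist G p p = 0"
  using path_dist_le[OF gpath.refl] path_dist_nonneg[of p p]
  by (cases "p \<in> points G") (force simp: path_dist_def)+

lemma Metric_space_path_dist: "Metric_space (points G) (path_dist G)"
  using path_dist_nonneg path_dist_sym path_dist_0 path_dist_triangle path_dist_refl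
  by unfold_locales blast+

lemma mspace_path_metric [simp]: "mspace (path_metric G) = points G"
  and mdist_path_metric [simp]: "mdist (path_metric G) = path_dist G"
  unfolding path_metric_def using Metric_space.mspace_metric Metric_space.mdist_metric
    Metric_space_path_dist by blast+

end

text \<open>
  For a metric graph all the counted sets are finite, since balls contain only finitely many edges.
\<close>

definition edges_in_ball :: "('v, 'e) mgraph \<Rightarrow> 'v \<Rightarrow> real \<Rightarrow> nat" where
  "edges_in_ball G v r =
    card {e \<in> arcs (skel G). Inner e ` {0<..<len G e} \<subseteq> mball_of (path_metric G) (Vertex v) r}"

definition growth_condition :: "('v, 'e) mgraph \<Rightarrow> bool" where
  "growth_condition G \<longleftrightarrow>
    (\<exists>k K. 0 < k \<and> (\<forall>e\<in>arcs (skel G). k \<le> cond G e \<and> cond G e \<le> K)) \<and>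
    (\<exists>v\<in>verts (skel G). \<forall>\<epsilon>>0. ((\<lambda>r. real (edges_in_ball G v r) * exp (- \<epsilon> * r)) \<longlongrightarrow> 0) at_top)"

abbreviation edge_slice :: "('v, 'e) mgraph \<Rightarrow> ('v, 'e) gpoint set \<Rightarrow> 'e \<Rightarrow> real set" where
  "edge_slice G A e \<equiv> {x \<in> {0<..<len G e}. Inner e x \<in> A}"

text \<open>The measure that restricts to \<open>cond G e\<close> times Lebesgue measure on \<open>e\<close>; vertices are null.\<close>

definition graph_measure :: "('v, 'e) mgraph \<Rightarrow> ('v, 'e) gpoint measure" where
  "graph_measure G = measure_of (points G)
    {A. A \<subseteq> points G \<and> (\<forall>e\<in>arcs (skel G). edge_slice G A e \<in> sets lebesgue)}
    (\<lambda>A. \<integral>\<^sup>+ e. ennreal (cond G e) * emeasure lebesgue (edge_slice G A e)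
           \<partial>count_space (arcs (skel G)))"

lemma space_graph_measure [simp]: "space (graph_measure G) = points G"
  unfolding graph_measure_def by (rule space_measure_of) auto

lemma sigma_algebra_graph:
  "sigma_algebra (points G)
     {A. A \<subseteq> points G \<and> (\<forall>e\<in>arcs (skel G). edge_slice G A e \<in> sets lebesgue)}"
  unfolding sigma_algebra_iff2
proof (intro conjI ballI allI impI)
  fix A assume A: "A \<in> {A. A \<subseteq> points G \<and> (\<forall>e\<in>arcs (skel G). edge_slice G A e \<in> sets lebesgue)}"
  have "edge_slice G (points G - A) e = {0<..<len G e} - edge_slice G A e"
    if "e \<in> arcs (skel G)" for e using that by (auto simp: points_def)
  with A show "points G - A \<in> {A. A \<subseteq> points G \<and> (\<forall>e\<in>arcs (skel G). edge_slice G A e \<in> sets lebesgue)}"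
    by auto
next
  fix A :: "nat \<Rightarrow> _"
  assume A: "range A \<subseteq> {A. A \<subseteq> points G \<and> (\<forall>e\<in>arcs (skel G). edge_slice G A e \<in> sets lebesgue)}"
  have "edge_slice G (\<Union>i. A i) e = (\<Union>i. edge_slice G (A i) e)" for e by auto
  with A show "(\<Union>i. A i) \<in> {A. A \<subseteq> points G \<and> (\<forall>e\<in>arcs (skel G). edge_slice G A e \<in> sets lebesgue)}"
    by (auto 0 3)
qed auto

lemma sets_graph_measure:
  "sets (graph_measure G) =
     {A. A \<subseteq> points G \<and> (\<forall>e\<in>arcs (skel G). edge_slice G A e \<in> sets lebesgue)}"
  unfolding graph_measure_def
  using sigma_algebra.sets_measure_of_eq[OF sigma_algebra_graph] by blast

lemma emeasure_graph_measure:
  assumes "A \<in> sets (graph_measure G)"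
  shows "emeasure (graph_measure G) A =
    (\<integral>\<^sup>+ e. ennreal (cond G e) * emeasure lebesgue (edge_slice G A e) \<partial>count_space (arcs (skel G)))"
proof (rule emeasure_measure_of[OF graph_measure_def _ _ _ assms])
  show "countably_additive (sets (graph_measure G)) (\<lambda>A.
    \<integral>\<^sup>+ e. ennreal (cond G e) * emeasure lebesgue (edge_slice G A e) \<partial>count_space (arcs (skel G)))"
  proof (rule countably_additiveI)
    fix A :: "nat \<Rightarrow> _"
    assume A: "range A \<subseteq> sets (graph_measure G)" "disjoint_family A"
    have "(\<Sum>i. emeasure lebesgue (edge_slice G (A i) e)) = emeasure lebesgue (edge_slice G (\<Union>i. A i) e)"
      if e: "e \<in> arcs (skel G)" for e
    proof -
      have "(\<Sum>i. emeasure lebesgue (edge_slice G (A i) e)) = emeasure lebesgue (\<Union>i. edge_slice G (A i) e)"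
      proof (rule suminf_emeasure)
        show "range (\<lambda>i. edge_slice G (A i) e) \<subseteq> sets lebesgue"
          using A(1) e by (auto simp: sets_graph_measure)
        show "disjoint_family (\<lambda>i. edge_slice G (A i) e)"
          using A(2) unfolding disjoint_family_on_def by blast
      qed
      also have "(\<Union>i. edge_slice G (A i) e) = edge_slice G (\<Union>i. A i) e" by auto
      finally show ?thesis .
    qed
    then show "(\<Sum>i. \<integral>\<^sup>+ e. ennreal (cond G e) * emeasure lebesgue (edge_slice G (A i) e) \<partial>count_space (arcs (skel G)))
      = (\<integral>\<^sup>+ e. ennreal (cond G e) * emeasure lebesgue (edge_slice G (\<Union>i. A i) e) \<partial>count_space (arcs (skel G)))"
      by (subst nn_integral_suminf[symmetric]) (auto intro!: nn_integral_cong)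
  qed
qed (auto simp: positive_def)

section \<open>Function spaces\<close>

text \<open>
  Each space is given by a set of complex functions together with a seminorm. As usual for \<open>L\<^sup>p\<close>,
  functions whose difference has seminorm \<open>0\<close> are identified; operators, semigroups and generators below
  are invariant under this identification. For the sup-norm it only discards the (irrelevant)
  values outside \<open>points G\<close>.
\<close>

datatype fun_space = Lp real | C0 | BUC

fun carr :: "('v, 'e) mgraph \<Rightarrow> fun_space \<Rightarrow> (('v, 'e) gpoint \<Rightarrow> complex) set" where
  "carr G (Lp p) = {f \<in> borel_measurable (graph_measure G).
     integrable (graph_measure G) (\<lambda>x. cmod (f x) powr p)}"
| "carr G C0 = {f. continuous_map (mtopology_of (path_metric G)) euclidean f \<and>
     (\<forall>\<epsilon>>0. \<exists>K. compactin (mtopology_of (path_metric G)) K \<and> (\<forall>x\<in>points G - K. cmod (f x) < \<epsilon>))}"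
| "carr G BUC = {f. uniformly_continuous_map (path_metric G) euclidean_metric f \<and>
     bounded (f ` points G)}"

fun snorm :: "('v, 'e) mgraph \<Rightarrow> fun_space \<Rightarrow> (('v, 'e) gpoint \<Rightarrow> complex) \<Rightarrow> real" where
  "snorm G (Lp p) f = (\<integral>x. cmod (f x) powr p \<partial>graph_measure G) powr (1 / p)"
| "snorm G C0 f = (SUP x\<in>points G. cmod (f x))"
| "snorm G BUC f = (SUP x\<in>points G. cmod (f x))"

section \<open>The Laplacian\<close>

definition test_functions :: "real \<Rightarrow> (real \<Rightarrow> real) set" where
  "test_functions l = {\<phi>. (\<forall>k x. (deriv ^^ k) \<phi> differentiable (at x)) \<and>
     (\<exists>a b. 0 < a \<and> b < l \<and> (\<forall>x. x \<notin> {a..b} \<longrightarrow> \<phi> x = 0))}"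

text \<open>
  \<open>second_deriv X l u g\<close>: \<open>g\<close> is the second derivative of \<open>u\<close> on \<open>(0, l)\<close>, in the weak sense
  for \<open>L\<^sup>p\<close> and in the classical sense for spaces of continuous functions.
\<close>

fun second_deriv :: "fun_space \<Rightarrow> real \<Rightarrow> (real \<Rightarrow> complex) \<Rightarrow> (real \<Rightarrow> complex) \<Rightarrow> bool" where
  "second_deriv (Lp p) l u g \<longleftrightarrow> (\<forall>\<phi>\<in>test_functions l.
     (LINT x:{0<..<l}|lebesgue. (deriv ^^ 2) \<phi> x *\<^sub>R u x) = (LINT x:{0<..<l}|lebesgue. \<phi> x *\<^sub>R g x))"
| "second_deriv C0 l u g \<longleftrightarrow> (\<exists>w. \<forall>x\<in>{0<..<l}.
     (u has_vector_derivative w x) (at x) \<and> (w has_vector_derivative g x) (at x))"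
| "second_deriv BUC l u g \<longleftrightarrow> (\<exists>w. \<forall>x\<in>{0<..<l}.
     (u has_vector_derivative w x) (at x) \<and> (w has_vector_derivative g x) (at x))"

text \<open>
  The one-sided limits of \<open>u'\<close> exist for all functions to which this is applied below: there \<open>u\<close> is
  continuous and its second derivative is integrable on \<open>e\<close>, so \<open>u\<close> is \<open>C\<^sup>1\<close> up to the end points.
\<close>

definition normal_deriv :: "('v, 'e) mgraph \<Rightarrow> (('v, 'e) gpoint \<Rightarrow> complex) \<Rightarrow> 'e \<Rightarrow> 'v \<Rightarrow> complex" where
  "normal_deriv G u e v =
    (let u' = (\<lambda>x. vector_derivative (\<lambda>s. u (Inner e s)) (at x)) in
     if v = tail (skel G) e then cond G e *\<^sub>R Lim (at_right 0) u'
     else - (cond G e *\<^sub>R Lim (at_left (len G e)) u'))"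

definition kirchhoff :: "('v, 'e) mgraph \<Rightarrow> (('v, 'e) gpoint \<Rightarrow> complex) \<Rightarrow> bool" where
  "kirchhoff G u \<longleftrightarrow> (\<forall>v\<in>verts (skel G). (\<Sum>e\<in>incident G v. normal_deriv G u e v) = 0)"

text \<open>
  Unbounded operators are represented by their graphs. Here \<open>u\<close> is the continuous representative
  of \<open>f\<close>, and \<open>g\<close> is \<open>\<Delta>f\<close>.
\<close>

definition laplacian :: "('v, 'e) mgraph \<Rightarrow> fun_space
    \<Rightarrow> ((('v, 'e) gpoint \<Rightarrow> complex) \<times> (('v, 'e) gpoint \<Rightarrow> complex)) set" where
  "laplacian G X = {(f, g). f \<in> carr G X \<and> g \<in> carr G X \<and>
     (\<exists>u\<in>carr G X. snorm G X (\<lambda>x. u x - f x) = 0 \<and>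
        continuous_map (mtopology_of (path_metric G)) euclidean u \<and> kirchhoff G u \<and>
        (\<forall>e\<in>arcs (skel G).
           second_deriv X (len G e) (\<lambda>s. u (Inner e s)) (\<lambda>s. g (Inner e s))))}"

definition neg_op :: "(('a \<Rightarrow> complex) \<times> ('a \<Rightarrow> complex)) set \<Rightarrow> (('a \<Rightarrow> complex) \<times> ('a \<Rightarrow> complex)) set"
  where "neg_op A = {(f, \<lambda>x. - g x) |f g. (f, g) \<in> A}"

text \<open>The operator \<open>-(-\<Delta>)\<^sup>m\<close>; relational powers have exactly the domains of powers of operators.\<close>

definition poly_laplacian :: "('v, 'e) mgraph \<Rightarrow> fun_space \<Rightarrow> nat
    \<Rightarrow> ((('v, 'e) gpoint \<Rightarrow> complex) \<times> (('v, 'e) gpoint \<Rightarrow> complex)) set" where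
  "poly_laplacian G X m = neg_op (neg_op (laplacian G X) ^^ m)"

section \<open>Semigroups on a seminormed space of functions\<close>

definition bounded_op :: "('a \<Rightarrow> complex) set \<Rightarrow> (('a \<Rightarrow> complex) \<Rightarrow> real)
    \<Rightarrow> (('a \<Rightarrow> complex) \<Rightarrow> ('a \<Rightarrow> complex)) \<Rightarrow> bool" where
  "bounded_op X N S \<longleftrightarrow>
     (\<forall>f\<in>X. S f \<in> X) \<and>
     (\<forall>f\<in>X. \<forall>g\<in>X. N (\<lambda>x. S (\<lambda>y. f y + g y) x - (S f x + S g x)) = 0) \<and>
     (\<forall>f\<in>X. \<forall>a. N (\<lambda>x. S (\<lambda>y. a * f y) x - a * S f x) = 0) \<and>
     (\<exists>M. \<forall>f\<in>X. N (S f) \<le> M * N f)"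

definition op_norm :: "('a \<Rightarrow> complex) set \<Rightarrow> (('a \<Rightarrow> complex) \<Rightarrow> real)
    \<Rightarrow> (('a \<Rightarrow> complex) \<Rightarrow> ('a \<Rightarrow> complex)) \<Rightarrow> real" where
  "op_norm X N S = (SUP f\<in>{f \<in> X. N f \<le> 1}. N (S f))"

definition C0_semigroup :: "('a \<Rightarrow> complex) set \<Rightarrow> (('a \<Rightarrow> complex) \<Rightarrow> real)
    \<Rightarrow> (real \<Rightarrow> ('a \<Rightarrow> complex) \<Rightarrow> ('a \<Rightarrow> complex)) \<Rightarrow> bool" where
  "C0_semigroup X N T \<longleftrightarrow>
     (\<forall>t\<ge>0. bounded_op X N (T t)) \<and>
     (\<forall>f\<in>X. N (\<lambda>x. T 0 f x - f x) = 0) \<and>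
     (\<forall>s\<ge>0. \<forall>t\<ge>0. \<forall>f\<in>X. N (\<lambda>x. T (s + t) f x - T s (T t f) x) = 0) \<and>
     (\<forall>f\<in>X. ((\<lambda>t. N (\<lambda>x. T t f x - f x)) \<longlongrightarrow> 0) (at_right 0))"

definition generator :: "('a \<Rightarrow> complex) set \<Rightarrow> (('a \<Rightarrow> complex) \<Rightarrow> real)
    \<Rightarrow> (real \<Rightarrow> ('a \<Rightarrow> complex) \<Rightarrow> ('a \<Rightarrow> complex))
    \<Rightarrow> (('a \<Rightarrow> complex) \<times> ('a \<Rightarrow> complex)) set" where
  "generator X N T = {(f, g). f \<in> X \<and> g \<in> X \<and>
     ((\<lambda>h. N (\<lambda>x. (T h f x - f x) /\<^sub>R h - g x)) \<longlongrightarrow> 0) (at_right 0)}"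

definition uniformly_stable :: "('a \<Rightarrow> complex) set \<Rightarrow> (('a \<Rightarrow> complex) \<Rightarrow> real)
    \<Rightarrow> (real \<Rightarrow> ('a \<Rightarrow> complex) \<Rightarrow> ('a \<Rightarrow> complex)) \<Rightarrow> bool" where
  "uniformly_stable X N T \<longleftrightarrow> ((\<lambda>t. op_norm X N (T t)) \<longlongrightarrow> 0) at_top"

end

(*
  If the semigroup were uniformly stable, then writing T(t) f - f as the integral of T(s) A f over [0, t],
  with |T(t)| <= 1/2, would give |f| <= const |A f| on the domain of its generator A. The integral is
  replaced by a telescoping sum with small steps, and the bound of |T(s)| for s in [0, t] comes from the
  uniform boundedness principle. It remains to find f for which (-Delta)^m f is small relative to f.

  Take psi(w) = exp(-eps d(v, w)) on the vertices and interpolate on each edge by a fixed polynomial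
  step, flat to order 2m+1 at both ends: the resulting function and its Laplacians satisfy all vertex
  conditions. On an edge, (-Delta)^k f with 1 <= k <= m is bounded by a constant times the
  difference of psi at the end points, hence by O(eps) |f| pointwise, uniformly over the graph. Such a
  pointwise bound carries over to all the norms at once, and f lies in L^p because the number of edges
  grows subexponentially.
*)
theory Submission
  imports Defs
begin

section \<open>Uniformly stable semigroups on complete seminormed spaces\<close>

text \<open>The lower bound drawn from stability says that 0 is not an approximate eigenvalue of the
  generator; the interpolations show that it is one. Neither spectral theory nor kernel estimates
  enter, so all the spaces and all m are treated alike. Two obstacles shape the details. The spaces
  consist of functions, and linearity and the semigroup law hold only up to functions of seminorm
  zero, so equality is replaced by a vanishing seminorm of the difference. And exp(-eps d(v, x))
  itself is no candidate for f: the distance may have a kink inside an edge, and its slopes need not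
  balance at a vertex. Only its vertex values are kept. Flatness acts through both parities:
  derivatives of even order must agree at a vertex when seen from different edges, so that the
  powers of the Laplacian are continuous, and those of odd order give the Kirchhoff condition. The
  exponential is chosen because its values at adjacent vertices have a ratio close to 1. The
  variation is thus small relative to the function everywhere, also far out where the function
  itself is tiny.\<close>

locale seminorm_space =
  fixes X :: "('a \<Rightarrow> complex) set" and N :: "('a \<Rightarrow> complex) \<Rightarrow> real"
  assumes add_closed: "f \<in> X \<Longrightarrow> g \<in> X \<Longrightarrow> (\<lambda>x. f x + g x) \<in> X"
    and scale_closed: "f \<in> X \<Longrightarrow> (\<lambda>x. a * f x) \<in> X"
    and N_add: "f \<in> X \<Longrightarrow> g \<in> X \<Longrightarrow> N (\<lambda>x. f x + g x) \<le> N f + N g"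
    and N_scale: "f \<in> X \<Longrightarrow> N (\<lambda>x. a * f x) = cmod a * N f"
begin

lemma diff_closed: "f \<in> X \<Longrightarrow> g \<in> X \<Longrightarrow> (\<lambda>x. f x - g x) \<in> X"
  using add_closed[of f "\<lambda>x. (-1) * g x"] scale_closed[of g "-1"] by simp

lemma N_minus_commute: "f \<in> X \<Longrightarrow> g \<in> X \<Longrightarrow> N (\<lambda>x. f x - g x) = N (\<lambda>x. g x - f x)"
  using N_scale[OF diff_closed[of f g], of "-1"] by simp

lemma N_triangle:
  "f \<in> X \<Longrightarrow> g \<in> X \<Longrightarrow> h \<in> X \<Longrightarrow> N (\<lambda>x. f x - h x) \<le> N (\<lambda>x. f x - g x) + N (\<lambda>x. g x - h x)"
  using N_add[OF diff_closed[of f g] diff_closed[of g h]] by simp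

lemma N_le_diff: "f \<in> X \<Longrightarrow> g \<in> X \<Longrightarrow> N f \<le> N (\<lambda>x. f x - g x) + N g"
  using N_add[OF diff_closed[of f g], of g] by simp

lemma N_diff_le: "f \<in> X \<Longrightarrow> g \<in> X \<Longrightarrow> N (\<lambda>x. f x - g x) \<le> N f + N g"
  using N_add[of f "\<lambda>x. (-1) * g x"] N_scale[of g "-1"] scale_closed[of g "-1"] by simp

lemma N_nonneg: "f \<in> X \<Longrightarrow> 0 \<le> N f"
  using N_diff_le[of f f] N_scale[of f 0] by simp

text \<open>Turns a law that holds up to a null function into an equality of seminorms; linearity of
  operators is used below in this form.\<close>

lemma N_cong: "f \<in> X \<Longrightarrow> g \<in> X \<Longrightarrow> N (\<lambda>x. f x - g x) = 0 \<Longrightarrow> N f = N g"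
  using N_le_diff[of f g] N_le_diff[of g f] N_minus_commute[of f g] by simp

context
  fixes S assumes S: "bounded_op X N S"
begin

lemma op_closed: "f \<in> X \<Longrightarrow> S f \<in> X"
  using S unfolding bounded_op_def by blast

lemma N_op_scale:
  assumes "f \<in> X" shows "N (S (\<lambda>x. a * f x)) = cmod a * N (S f)"
proof -
  have "N (\<lambda>x. S (\<lambda>y. a * f y) x - a * S f x) = 0"
    using S assms unfolding bounded_op_def by blast
  then have "N (S (\<lambda>x. a * f x)) = N (\<lambda>x. a * S f x)"
    using N_cong assms op_closed scale_closed by simp
  then show ?thesis using N_scale assms op_closed by simp
qed

text \<open>Additivity applied to \<open>f - g\<close> and \<open>g\<close>: \<open>S f\<close> and
  \<open>S (f - g) + S g\<close> differ by a null function.\<close>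

lemma N_op_diff:
  assumes f: "f \<in> X" and g: "g \<in> X"
  shows "N (\<lambda>x. S f x - S g x) = N (S (\<lambda>x. f x - g x))"
proof -
  let ?d = "\<lambda>x. f x - g x"
  have d: "?d \<in> X" using diff_closed f g by blast
  have "\<forall>f\<in>X. \<forall>g\<in>X. N (\<lambda>x. S (\<lambda>y. f y + g y) x - (S f x + S g x)) = 0"
    using S unfolding bounded_op_def by blast
  from bspec[OF bspec[OF this d] g]
  have "N (\<lambda>x. (S f x - S g x) - S ?d x) = 0" by (simp add: algebra_simps)
  then show ?thesis using N_cong d f g op_closed diff_closed by simp
qed

text \<open>\<open>op_norm\<close> is a supremum of reals, which is informative only over a set
  bounded above. The constant in \<open>bounded_op\<close> may be negative, hence the absolute
  value.\<close>

lemma bdd_above_op: "bdd_above ((\<lambda>f. N (S f)) ` {f \<in> X. N f \<le> 1})"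
proof -
  obtain M where M: "\<And>f. f \<in> X \<Longrightarrow> N (S f) \<le> M * N f"
    using S unfolding bounded_op_def by blast
  have "N (S f) \<le> \<bar>M\<bar>" if f: "f \<in> X" "N f \<le> 1" for f
  proof -
    have "M * N f \<le> \<bar>M\<bar> * N f" using N_nonneg[OF f(1)] by (intro mult_right_mono) auto
    also have "\<dots> \<le> \<bar>M\<bar>" using f by (simp add: mult_left_le)
    finally show ?thesis using M[OF f(1)] by linarith
  qed
  then show ?thesis by (intro bdd_aboveI[of _ "\<bar>M\<bar>"]) auto
qed

lemma op_norm_upper: "f \<in> X \<Longrightarrow> N f \<le> 1 \<Longrightarrow> N (S f) \<le> op_norm X N S"
  unfolding op_norm_def by (intro cSUP_upper bdd_above_op) auto

lemma N_op_le:
  assumes f: "f \<in> X" shows "N (S f) \<le> op_norm X N S * N f"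
\<comment> \<open>A null function cannot be normalised; for it the multiple of \<open>N f\<close>
  provided by \<open>bounded_op\<close> is already 0.\<close>
proof (cases "N f = 0")
  case True
  obtain M where "N (S f) \<le> M * N f" using S f unfolding bounded_op_def by blast
  then show ?thesis using True by simp
next
  case False
  then have p: "N f > 0" using N_nonneg[OF f] by linarith
  let ?a = "of_real (1 / N f) :: complex"
  have "N (S (\<lambda>x. ?a * f x)) \<le> op_norm X N S"
    using p N_scale[OF f, of ?a] by (intro op_norm_upper scale_closed f) (simp add: norm_divide)
  then have "1 / N f * N (S f) \<le> op_norm X N S"
    using p N_op_scale[OF f, of ?a] by (simp add: norm_divide)
  then show ?thesis using p by (simp add: field_simps)
qed

text \<open>
  The key step in Sokal's proof of the uniform boundedness principle: as
  \<open>2 S z = S (x + z) - S (x - z)\<close>, one of \<open>x + z\<close> and \<open>x - z\<close> has an image at least as large as \<open>S z\<close>.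
\<close>

lemma ball_image_large:
  assumes x: "x \<in> X" and r: "r > 0" and c: "c < op_norm X N S"
  shows "\<exists>y\<in>X. N (\<lambda>t. y t - x t) \<le> r \<and> r * c \<le> N (S y)"
proof -
  have "{f \<in> X. N f \<le> 1} \<noteq> {}"
    using scale_closed[OF x, of 0] N_scale[OF x, of 0] by (auto intro!: exI[of _ "\<lambda>_. 0"])
  then obtain w where w: "w \<in> X" "N w \<le> 1" "c < N (S w)"
    using c bdd_above_op unfolding op_norm_def by (subst (asm) less_cSUP_iff) auto
  define z where "z = (\<lambda>t. of_real r * w t)"
  have z: "z \<in> X" "N z \<le> r" "r * c \<le> N (S z)"
    unfolding z_def using w r N_scale[of w "of_real r"] N_op_scale[of w "of_real r"] scale_closed
    by (simp_all add: mult_left_le)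
  let ?p = "\<lambda>t. x t + z t" and ?m = "\<lambda>t. x t - z t"
  have pm: "?p \<in> X" "?m \<in> X" using x z add_closed diff_closed by auto
  have "2 * N (S z) = N (S (\<lambda>t. 2 * z t))" using N_op_scale[OF z(1), of 2] by simp
  also have "\<dots> = N (\<lambda>t. S ?p t - S ?m t)" using N_op_diff[OF pm] by simp
  also have "\<dots> \<le> N (S ?p) + N (S ?m)" using N_diff_le op_closed pm by blast
  finally have "r * c \<le> N (S ?p) \<or> r * c \<le> N (S ?m)" using z(3) by linarith
  then show ?thesis
  proof
    assume "r * c \<le> N (S ?p)"
    then show ?thesis using pm z by (intro bexI[of _ ?p]) auto
  next
    assume "r * c \<le> N (S ?m)"
    then show ?thesis using pm z N_scale[OF z(1), of "-1"] by (intro bexI[of _ ?m]) auto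
  qed
qed

end

text \<open>The telescoped steps form a geometric sum, whose exact value is kept so that the
  induction closes. With ratio 1/3 all steps after the n-th together move by at most
  \<open>1/2 * (1/3) ^ n\<close>, less than what the uniform boundedness argument gains in step
  n.\<close>

lemma geometric_dist_le:
  assumes u: "\<And>n. u n \<in> X" and step: "\<And>n. N (\<lambda>x. u (Suc n) x - u n x) \<le> (1/3) ^ n"
  shows "N (\<lambda>x. u (n + k) x - u n x) \<le> 3/2 * (1/3) ^ n * (1 - (1/3) ^ k)"
proof (induction k)
  case 0
  then show ?case using N_scale[OF u[of n], of 0] by simp
next
  case (Suc k)
  have "N (\<lambda>x. u (n + Suc k) x - u n x) \<le>
    N (\<lambda>x. u (Suc (n + k)) x - u (n + k) x) + N (\<lambda>x. u (n + k) x - u n x)"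
    using N_triangle[OF u u u] by simp
  also have "\<dots> \<le> (1/3) ^ (n + k) + 3/2 * (1/3) ^ n * (1 - (1/3) ^ k)"
    using step Suc by (intro add_mono)
  also have "\<dots> = 3/2 * (1/3) ^ n * (1 - (1/3) ^ Suc k)" by (simp add: power_add field_simps)
  finally show ?case .
qed

end

text \<open>Completeness is asked for sequences with steps at most \<open>(1/3) ^ n\<close>. Every
  Cauchy sequence has such a subsequence, so this is full completeness, in the form in which the
  uniform boundedness argument needs it.\<close>

locale complete_seminorm = seminorm_space +
  assumes complete: "(\<And>n. u n \<in> X) \<Longrightarrow> (\<And>n. N (\<lambda>x. u (Suc n) x - u n x) \<le> (1/3) ^ n)
      \<Longrightarrow> \<exists>y\<in>X. (\<lambda>n. N (\<lambda>x. y x - u n x)) \<longlonglongrightarrow> 0"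
begin

lemma geometric_limit:
  assumes u: "\<And>n. u n \<in> X" and step: "\<And>n. N (\<lambda>x. u (Suc n) x - u n x) \<le> (1/3) ^ n"
  obtains y where "y \<in> X" "\<And>n. N (\<lambda>x. y x - u n x) \<le> 3/2 * (1/3) ^ n"
proof -
  obtain y where y: "y \<in> X" "(\<lambda>n. N (\<lambda>x. y x - u n x)) \<longlonglongrightarrow> 0"
    using complete[OF u step] by blast
  have "N (\<lambda>x. y x - u n x) \<le> 3/2 * (1/3) ^ n" for n
  proof (rule LIMSEQ_le_const)
    show "(\<lambda>k. N (\<lambda>x. y x - u (k + n) x) + 3/2 * (1/3) ^ n) \<longlonglongrightarrow> 3/2 * (1/3) ^ n"
      using tendsto_add[OF LIMSEQ_ignore_initial_segment[OF y(2), of n] tendsto_const] by simp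
    have "N (\<lambda>x. y x - u n x) \<le> N (\<lambda>x. y x - u (k + n) x) + 3/2 * (1/3) ^ n" for k
    proof -
      have "3/2 * (1/3) ^ n * (1 - (1/3) ^ k) \<le> 3/2 * (1/3) ^ n * (1::real)"
        by (intro mult_left_mono) auto
      then have "N (\<lambda>x. u (k + n) x - u n x) \<le> 3/2 * (1/3) ^ n"
        using order_trans[OF geometric_dist_le[OF u step, of n k]] by (metis add.commute mult.right_neutral)
      then show ?thesis using N_triangle[OF y(1) u[of "k+n"] u[of n]] by linarith
    qed
    then show "\<exists>K. \<forall>k\<ge>K. N (\<lambda>x. y x - u n x) \<le> N (\<lambda>x. y x - u (k + n) x) + 3/2 * (1/3) ^ n"
      by blast
  qed
  with y(1) that show ?thesis by blast
qed

section \<open>Local boundedness of semigroups and a lower bound for the generator\<close>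

context
  fixes T assumes T: "C0_semigroup X N T"
begin

lemma bounded_op_semigroup: "0 \<le> t \<Longrightarrow> bounded_op X N (T t)"
  using T unfolding C0_semigroup_def by blast

lemma semigroup_closed: "0 \<le> t \<Longrightarrow> f \<in> X \<Longrightarrow> T t f \<in> X"
  using op_closed bounded_op_semigroup by blast

text \<open>Strong continuity speaks of one function at a time. If the norms were unbounded near 0,
  there would be times \<open>s n\<close> tending to 0 with norms above \<open>4 ^ n\<close>, and a
  single \<open>y\<close> with \<open>T (s n) y\<close> unbounded, although \<open>T (s n) y\<close>
  tends to \<open>y\<close>. Completeness is what produces \<open>y\<close>.\<close>

lemma semigroup_bounded_near_0:
  "\<exists>\<delta>>0. \<exists>M. \<forall>s. 0 < s \<and> s < \<delta> \<longrightarrow> op_norm X N (T s) \<le> M"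
proof (rule ccontr)
  assume neg: "\<not> ?thesis"
  have "\<exists>s. 0 < s \<and> s < 1 / real (Suc n) \<and> 4 ^ n < op_norm X N (T s)" for n
    using neg by (meson not_le zero_less_divide_1_iff of_nat_0_less_iff zero_less_Suc)
  then obtain s where s: "\<And>n. 0 < s n" "\<And>n. s n < 1 / real (Suc n)"
      "\<And>n. 4 ^ n < op_norm X N (T (s n))" by metis
  let ?C = "\<lambda>n. op_norm X N (T (s n))"
  have C: "0 < ?C n" for n using s(3)[of n] zero_less_power[of "4::real" n] by linarith
  have bo: "bounded_op X N (T (s n))" for n using bounded_op_semigroup s(1)[of n] by simp
  \<comment> \<open>For empty \<open>X\<close> the supremum in \<open>op_norm\<close> is over the
    empty set, so it is the same at all times and bounds itself.\<close>
  have "X \<noteq> {}"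
  proof
    assume "X = {}"
    then have "op_norm X N (T a) = op_norm X N (T b)" for a b by (simp add: op_norm_def)
    with neg show False by (metis order_refl zero_less_one)
  qed
  then obtain x0 where x0: "x0 \<in> X" by blast
  \<comment> \<open>The factor 3/4 lies below 1, as the norm need not be attained, and above 1/2, so
    as to survive the later steps.\<close>
  have "\<exists>y. y \<in> X \<and> N (\<lambda>t. y t - x t) \<le> (1/3) ^ n \<and> (1/3) ^ n * (3/4 * ?C n) \<le> N (T (s n) y)"
    if x: "x \<in> X" for x n
  proof -
    have "(0::real) < (1/3) ^ n" "3/4 * ?C n < ?C n" using C[of n] by simp_all
    from ball_image_large[OF bo[of n] x this] show ?thesis by blast
  qed
  note step = this
  define Y where "Y x n = (SOME y. y \<in> X \<and> N (\<lambda>t. y t - x t) \<le> (1/3) ^ n \<and>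
      (1/3) ^ n * (3/4 * ?C n) \<le> N (T (s n) y))" for x n
  have Y: "Y x n \<in> X" "N (\<lambda>t. Y x n t - x t) \<le> (1/3) ^ n"
      "(1/3) ^ n * (3/4 * ?C n) \<le> N (T (s n) (Y x n))" if x: "x \<in> X" for x n
    using someI_ex[OF step[OF x, of n]] unfolding Y_def by blast+
  define u where "u = rec_nat x0 (\<lambda>n x. Y x n)"
  have uS: "u (Suc n) = Y (u n) n" for n by (simp add: u_def)
  have u: "u n \<in> X" for n by (induction n) (auto simp: u_def x0 Y(1))
  obtain y where y: "y \<in> X" "\<And>n. N (\<lambda>x. y x - u n x) \<le> 3/2 * (1/3) ^ n"
    using geometric_limit[of u] u Y(2)[OF u] uS by metis
  \<comment> \<open>Passing from \<open>u (Suc n)\<close> to the limit \<open>y\<close> costs at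
    most 1/2 of \<open>(1/3) ^ n\<close> times the norm, against the 3/4 gained. The remaining
    quarter grows because the norms exceed \<open>4 ^ n\<close>.\<close>
  have large: "1/4 * (4/3) ^ n \<le> N (T (s n) y)" for n
  proof -
    have "(1/3) ^ n * (3/4 * ?C n) \<le> N (T (s n) (u (Suc n)))" using Y(3)[OF u] uS by simp
    also have "\<dots> \<le> N (\<lambda>x. T (s n) (u (Suc n)) x - T (s n) y x) + N (T (s n) y)"
      using N_le_diff op_closed[OF bo] u y(1) by blast
    also have "N (\<lambda>x. T (s n) (u (Suc n)) x - T (s n) y x) = N (T (s n) (\<lambda>x. u (Suc n) x - y x))"
      using N_op_diff[OF bo] u y(1) by blast
    also have "\<dots> \<le> ?C n * N (\<lambda>x. u (Suc n) x - y x)"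
      using N_op_le[OF bo] diff_closed u y(1) by blast
    also have "\<dots> \<le> ?C n * (1/2 * (1/3) ^ n)"
      using y(2)[of "Suc n"] N_minus_commute[OF y(1) u[of "Suc n"]] C[of n]
      by (intro mult_left_mono) auto
    finally have "1/4 * (1/3) ^ n * ?C n \<le> N (T (s n) y)" by (simp add: field_simps)
    moreover have "1/4 * (1/3) ^ n * 4 ^ n \<le> 1/4 * (1/3) ^ n * ?C n"
      using s(3)[of n] by (intro mult_left_mono) auto
    ultimately show ?thesis by (simp add: power_divide)
  qed
  have s0: "s \<longlonglongrightarrow> 0"
    using s(1,2) by (intro tendsto_sandwich[OF _ _ tendsto_const LIMSEQ_inverse_real_of_nat])
      (auto intro!: eventuallyI less_imp_le simp: inverse_eq_divide)
  then have "filterlim s (at_right 0) sequentially"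
    using s(1) by (auto simp: filterlim_at less_imp_neq[symmetric] intro!: eventuallyI)
  moreover have "((\<lambda>t. N (\<lambda>x. T t y x - y x)) \<longlongrightarrow> 0) (at_right 0)"
    using T y(1) unfolding C0_semigroup_def by blast
  ultimately have "(\<lambda>n. N (\<lambda>x. T (s n) y x - y x)) \<longlonglongrightarrow> 0"
    using filterlim_compose by blast
  then have "eventually (\<lambda>n. N (\<lambda>x. T (s n) y x - y x) < 1) sequentially"
    by (rule order_tendstoD) simp
  moreover have "filterlim (\<lambda>n. 1/4 * (4/3::real) ^ n) at_top sequentially"
    by (intro filterlim_tendsto_pos_mult_at_top[OF tendsto_const]
        filterlim_at_infinity_imp_filterlim_at_top[OF filterlim_realpow_sequentially_gt1]) auto
  then have "eventually (\<lambda>n. 1 + N y < 1/4 * (4/3) ^ n) sequentially"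
    unfolding filterlim_at_top_dense by blast
  ultimately have "eventually (\<lambda>n. False) sequentially"
  proof eventually_elim
    case (elim n)
    then show ?case
      using large[of n] N_le_diff[OF semigroup_closed[of "s n" y] y(1)] s(1)[of n] y(1) by simp
  qed
  then show False by simp
qed

lemma N_semigroup_add:
  "0 \<le> s \<Longrightarrow> 0 \<le> t \<Longrightarrow> f \<in> X \<Longrightarrow> N (T (s + t) f) = N (T s (T t f))"
  using T N_cong[of "T (s + t) f" "T s (T t f)"] semigroup_closed unfolding C0_semigroup_def by simp

lemma N_semigroup_0: "f \<in> X \<Longrightarrow> N (T 0 f) = N f"
  using T N_cong[of "T 0 f" f] semigroup_closed unfolding C0_semigroup_def by simp

lemma N_semigroup_power_le:
  assumes "0 \<le> h" "0 \<le> M" "\<And>f. f \<in> X \<Longrightarrow> N (T h f) \<le> M * N f" "f \<in> X"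
  shows "N (T (real n * h) f) \<le> M ^ n * N f"
proof (induction n)
  case 0
  then show ?case using N_semigroup_0 assms by simp
next
  case (Suc n)
  have "N (T (real (Suc n) * h) f) = N (T h (T (real n * h) f))"
    using N_semigroup_add[of h "real n * h" f] assms by (simp add: algebra_simps)
  also have "\<dots> \<le> M * N (T (real n * h) f)" using assms semigroup_closed by simp
  also have "\<dots> \<le> M * (M ^ n * N f)" using Suc assms by (intro mult_left_mono)
  finally show ?case by (simp add: mult.assoc)
qed

text \<open>\<open>T s\<close> is the n-th power of \<open>T (s / n)\<close> up to null functions,
  and one \<open>n\<close> with \<open>t / \<delta> < n\<close> serves every \<open>s\<close> in the
  interval.\<close>

lemma semigroup_bounded_compact:
  "\<exists>M\<ge>0. \<forall>s\<in>{0..t}. \<forall>f\<in>X. N (T s f) \<le> M * N f"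
proof -
  obtain \<delta> M where \<delta>: "\<delta> > 0" and M: "\<And>s. 0 < s \<Longrightarrow> s < \<delta> \<Longrightarrow> op_norm X N (T s) \<le> M"
    using semigroup_bounded_near_0 by blast
  \<comment> \<open>The maximum with 1 covers time 0, where the operator is the identity up to null
    functions.\<close>
  define M' where "M' = max 1 M"
  obtain n where n: "t / \<delta> < real n" using reals_Archimedean2 by blast
  have small: "N (T s f) \<le> M' * N f" if s: "0 \<le> s" "s < \<delta>" and f: "f \<in> X" for s f
  proof (cases "s = 0")
    case True
    have "1 * N f \<le> M' * N f" using N_nonneg[OF f] by (intro mult_right_mono) (auto simp: M'_def)
    then show ?thesis using True N_semigroup_0[OF f] by simp
  next
    case False
    have "N (T s f) \<le> op_norm X N (T s) * N f"
      using N_op_le[OF bounded_op_semigroup] s f by blast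
    also have "\<dots> \<le> M' * N f"
      using M[of s] s False N_nonneg[OF f] by (intro mult_right_mono) (auto simp: M'_def)
    finally show ?thesis .
  qed
  have "N (T s f) \<le> M' ^ n * N f" if s: "s \<in> {0..t}" and f: "f \<in> X" for s f
  proof (cases "n = 0")
    case True
    then have "t < 0" using n \<delta> by (simp add: divide_less_0_iff)
    with s show ?thesis by simp
  next
    case False
    have "s < \<delta> * real n" using n s \<delta> by (simp add: field_simps)
    then have "s / real n < \<delta>" "0 \<le> s / real n" using False s by (simp_all add: field_simps)
    then show ?thesis
      using N_semigroup_power_le[of "s / real n" M' f n] small f False by (simp add: M'_def)
  qed
  then show ?thesis by (intro exI[of _ "M' ^ n"]) (auto simp: M'_def)
qed

text \<open>\<open>T (n h) f - f\<close> telescopes into the terms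
  \<open>T (i h) (T h f - f)\<close> with i < n, and all times \<open>i h\<close> lie in the
  interval where \<open>M\<close> is a bound.\<close>

lemma N_semigroup_diff_le:
  assumes M: "\<And>s f. s \<in> {0..t} \<Longrightarrow> f \<in> X \<Longrightarrow> N (T s f) \<le> M * N f"
    and h: "0 \<le> h" "real n * h \<le> t" and f: "f \<in> X"
  shows "N (\<lambda>x. T (real n * h) f x - f x) \<le> real n * (M * N (\<lambda>x. T h f x - f x))"
  using h(2)
proof (induction n)
  case 0
  have "N (\<lambda>x. T 0 f x - f x) = 0" using T f unfolding C0_semigroup_def by blast
  then show ?case by simp
next
  case (Suc n)
  let ?s = "real n * h"
  have s: "0 \<le> ?s" "?s \<le> t" using Suc.prems h by (auto simp: algebra_simps)
  have Th: "T h f \<in> X" "T ?s f \<in> X" "T ?s (T h f) \<in> X" "T (?s + h) f \<in> X"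
    using semigroup_closed s h f by auto
  have "N (\<lambda>x. T (?s + h) f x - f x) \<le> N (\<lambda>x. T (?s + h) f x - T ?s f x) + N (\<lambda>x. T ?s f x - f x)"
    using N_triangle Th f by blast
  also have "N (\<lambda>x. T (?s + h) f x - T ?s f x) \<le>
      N (\<lambda>x. T (?s + h) f x - T ?s (T h f) x) + N (\<lambda>x. T ?s (T h f) x - T ?s f x)"
    using N_triangle Th f by blast
  also have "N (\<lambda>x. T (?s + h) f x - T ?s (T h f) x) = 0"
    using T s h f unfolding C0_semigroup_def by blast
  also have "N (\<lambda>x. T ?s (T h f) x - T ?s f x) = N (T ?s (\<lambda>x. T h f x - f x))"
    using N_op_diff[OF bounded_op_semigroup[OF s(1)]] Th f by blast
  also have "\<dots> \<le> M * N (\<lambda>x. T h f x - f x)" using M s diff_closed Th f by simp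
  also have "N (\<lambda>x. T ?s f x - f x) \<le> real n * (M * N (\<lambda>x. T h f x - f x))"
    using Suc.IH s by simp
  finally show ?case by (simp add: algebra_simps)
qed

text \<open>For \<open>h = t / n\<close> the telescoped bound is \<open>t * M\<close> times the
  seminorm of the difference quotient at step \<open>h\<close>, and the quotients tend to
  \<open>g\<close>. Only the right derivative at time 0 is used.\<close>

lemma N_semigroup_generator_le:
  assumes M: "\<And>s f. s \<in> {0..t} \<Longrightarrow> f \<in> X \<Longrightarrow> N (T s f) \<le> M * N f" "0 \<le> M" and t: "0 < t"
    and fg: "(f, g) \<in> generator X N T"
  shows "N (\<lambda>x. T t f x - f x) \<le> t * M * N g"
proof (rule LIMSEQ_le_const)
  have f: "f \<in> X" and g: "g \<in> X" and lim:
    "((\<lambda>h. N (\<lambda>x. (T h f x - f x) /\<^sub>R h - g x)) \<longlongrightarrow> 0) (at_right 0)"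
    using fg unfolding generator_def by auto
  define h where "h n = t / real (Suc n)" for n
  have h0: "h n > 0" for n using t by (simp add: h_def)
  have "(\<lambda>n. t * inverse (real (Suc n))) \<longlonglongrightarrow> t * 0"
    by (intro tendsto_mult tendsto_const LIMSEQ_inverse_real_of_nat)
  then have "h \<longlonglongrightarrow> 0"
    unfolding h_def divide_inverse by simp
  then have "filterlim h (at_right 0) sequentially"
    using h0 by (auto simp: filterlim_at less_imp_neq[symmetric] intro!: eventuallyI)
  then have "(\<lambda>n. N (\<lambda>x. (T (h n) f x - f x) /\<^sub>R h n - g x)) \<longlonglongrightarrow> 0"
    using filterlim_compose[OF lim] by blast
  from tendsto_mult[OF tendsto_const tendsto_add[OF this tendsto_const]]
  show "(\<lambda>n. t * M * (N (\<lambda>x. (T (h n) f x - f x) /\<^sub>R h n - g x) + N g)) \<longlonglongrightarrow> t * M * N g"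
    by simp
  have "N (\<lambda>x. T t f x - f x) \<le> t * M * (N (\<lambda>x. (T (h n) f x - f x) /\<^sub>R h n - g x) + N g)" for n
  proof -
    let ?d = "\<lambda>x. T (h n) f x - f x" and ?q = "\<lambda>x. of_real (1 / h n) * (T (h n) f x - f x)"
    have d: "?d \<in> X" using diff_closed semigroup_closed f h0[of n] by simp
    then have q: "?q \<in> X" by (rule scale_closed)
    have "N ?d / h n = N ?q" using N_scale[OF d, of "of_real (1 / h n)"] h0[of n]
      by (simp add: norm_divide)
    also have "\<dots> \<le> N (\<lambda>x. ?q x - g x) + N g" using N_le_diff q g by blast
    also have "(\<lambda>x. ?q x - g x) = (\<lambda>x. (T (h n) f x - f x) /\<^sub>R h n - g x)"
      by (simp add: scaleR_conv_of_real divide_inverse)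
    finally have *: "N ?d \<le> h n * (N (\<lambda>x. (T (h n) f x - f x) /\<^sub>R h n - g x) + N g)"
      using h0[of n] by (simp add: field_simps)
    have th: "real (Suc n) * h n = t" by (simp add: h_def)
    have "N (\<lambda>x. T t f x - f x) \<le> real (Suc n) * (M * N ?d)"
      using N_semigroup_diff_le[of t M "h n" "Suc n" f] M(1) h0[of n] th f by simp
    also have "\<dots> \<le> real (Suc n) * (M * (h n * (N (\<lambda>x. (T (h n) f x - f x) /\<^sub>R h n - g x) + N g)))"
      using * M(2) by (intro mult_left_mono) auto
    also have "\<dots> = t * M * (N (\<lambda>x. (T (h n) f x - f x) /\<^sub>R h n - g x) + N g)"
      unfolding th[symmetric] by (simp only: mult_ac)
    finally show ?thesis .
  qed
  then show "\<exists>K. \<forall>n\<ge>K. N (\<lambda>x. T t f x - f x) \<le>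
      t * M * (N (\<lambda>x. (T (h n) f x - f x) /\<^sub>R h n - g x) + N g)" by blast
qed

lemma uniformly_stable_generator_bounded_below:
  assumes st: "uniformly_stable X N T"
  obtains C where "0 \<le> C" "\<And>f g. (f, g) \<in> generator X N T \<Longrightarrow> N f \<le> C * N g"
proof -
  have "eventually (\<lambda>t. op_norm X N (T t) < 1/2) at_top"
    using st unfolding uniformly_stable_def by (rule order_tendstoD) simp
  then obtain t0 where "\<And>t. t \<ge> t0 \<Longrightarrow> op_norm X N (T t) < 1/2"
    unfolding eventually_at_top_linorder by blast
  then obtain t where t: "0 < t" "op_norm X N (T t) < 1/2" by (meson max.cobounded1 less_max_iff_disj zero_less_one max.cobounded2)
  obtain M where M: "0 \<le> M" "\<And>s f. s \<in> {0..t} \<Longrightarrow> f \<in> X \<Longrightarrow> N (T s f) \<le> M * N f"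
    using semigroup_bounded_compact[of t] by blast
  \<comment> \<open>The triangle inequality through \<open>T t f\<close> leaves half of
    \<open>N f\<close> on the right; absorbing it gives the factor 2.\<close>
  have "N f \<le> 2 * t * M * N g" if fg: "(f, g) \<in> generator X N T" for f g
  proof -
    have f: "f \<in> X" using fg unfolding generator_def by auto
    have Tf: "T t f \<in> X" using semigroup_closed t f by simp
    have "N (T t f) \<le> op_norm X N (T t) * N f" using N_op_le bounded_op_semigroup t f by simp
    also have "\<dots> \<le> 1/2 * N f" using t N_nonneg[OF f] by (intro mult_right_mono) auto
    finally show ?thesis
      using N_semigroup_generator_le[OF M(2,1) t(1) fg] N_le_diff[OF f Tf]
        N_minus_commute[OF f Tf] by linarith
  qed
  then show ?thesis using that[of "2 * t * M"] t M by simp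
qed

end

end

section \<open>Completeness of the function spaces\<close>

lemma powr_convex_nonneg:
  assumes "p \<ge> 1" shows "convex_on {0..} (\<lambda>x::real. x powr p)"
proof (rule convex_onI)
  fix t x y :: real
  assume t: "0 < t" "t < 1" and "x \<in> {0..}" "y \<in> {0..}"
  then have xy: "0 \<le> x" "0 \<le> y" by auto
  have *: "(s * z) powr p \<le> s * z powr p" if "0 < s" "s < 1" for s z :: real
    using powr_le_one_le[of s p] that assms by (simp add: powr_mult mult_right_mono)
  show "((1 - t) *\<^sub>R x + t *\<^sub>R y) powr p \<le> (1 - t) * x powr p + t * y powr p"
  proof (cases "x = 0 \<or> y = 0")
    case True
    then show ?thesis using *[of t y] *[of "1-t" x] t assms by auto
  next
    case False
    then show ?thesis
      using convex_onD[OF powr_convex[OF assms], of t x y] t xy by simp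
  qed
qed simp

text \<open>Convexity at the points \<open>u / a\<close> and \<open>v / b\<close> with weights
  \<open>a / (a + b)\<close> and \<open>b / (a + b)\<close>. For \<open>a\<close> and
  \<open>b\<close> close to the norms of two functions, integration gives Minkowski's inequality
  without a detour through Hoelder's.\<close>

lemma powr_add_le:
  fixes a b u v p :: real
  assumes "1 \<le> p" "0 < a" "0 < b" "0 \<le> u" "0 \<le> v"
  shows "(u + v) powr p \<le> (a + b) powr (p - 1) * (a powr (1 - p) * u powr p + b powr (1 - p) * v powr p)"
proof -
  have 1: "1 - b / (a + b) = a / (a + b)" using assms by (simp add: field_simps)
  have "((1 - b / (a + b)) *\<^sub>R (u / a) + (b / (a + b)) *\<^sub>R (v / b)) powr p
      \<le> (1 - b / (a + b)) * (u / a) powr p + (b / (a + b)) * (v / b) powr p"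
    using assms by (intro convex_onD[OF powr_convex_nonneg]) auto
  moreover have "(1 - b / (a + b)) *\<^sub>R (u / a) + (b / (a + b)) *\<^sub>R (v / b) = (u + v) / (a + b)"
    unfolding 1 using assms by (simp add: add_divide_distrib)
  ultimately have "(u + v) powr p / (a + b) powr p \<le>
      (a / (a + b)) * (u powr p / a powr p) + (b / (a + b)) * (v powr p / b powr p)"
    unfolding 1 by (simp add: powr_divide)
  then have "(u + v) powr p \<le> (a + b) powr p *
      ((a / (a + b)) * (u powr p / a powr p) + (b / (a + b)) * (v powr p / b powr p))"
    using assms by (simp add: pos_divide_le_eq mult.commute)
  also have "\<dots> = (a + b) powr p / (a + b) * (a / a powr p * u powr p + b / b powr p * v powr p)"
    by (simp add: algebra_simps)
  also have "\<dots> = (a + b) powr (p - 1) * (a powr (1 - p) * u powr p + b powr (1 - p) * v powr p)"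
    using assms by (simp add: powr_diff)
  finally show ?thesis .
qed

locale lp_space =
  fixes M :: "'a measure" and p :: real
  assumes p: "1 \<le> p"
begin

definition carrier :: "('a \<Rightarrow> complex) set" where
  "carrier = {f \<in> borel_measurable M. integrable M (\<lambda>x. cmod (f x) powr p)}"

definition pint :: "('a \<Rightarrow> complex) \<Rightarrow> real" where
  "pint f = (\<integral>x. cmod (f x) powr p \<partial>M)"

definition N :: "('a \<Rightarrow> complex) \<Rightarrow> real" where
  "N f = pint f powr (1 / p)"

lemma pint_nonneg: "0 \<le> pint f"
  unfolding pint_def by (intro integral_nonneg_AE) auto

lemma N_le_iff: "0 \<le> c \<Longrightarrow> N f \<le> c \<longleftrightarrow> pint f \<le> c powr p"
proof -
  assume c: "0 \<le> c"
  have 1: "(c powr p) powr (1 / p) = c" using c p by (simp add: powr_powr)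
  have 2: "(pint f powr (1 / p)) powr p = pint f" using pint_nonneg p by (simp add: powr_powr)
  show ?thesis
    unfolding N_def using powr_mono2[of "1/p" "pint f" "c powr p"] powr_mono2[of p "pint f powr (1/p)" c]
      pint_nonneg[of f] p c 1 2 by auto
qed

lemma integrable_add_powr:
  assumes f: "f \<in> carrier" and g: "g \<in> carrier" and ab: "0 < a" "0 < b"
  shows "(\<lambda>x. f x + g x) \<in> carrier"
    and "pint (\<lambda>x. f x + g x) \<le>
      (a + b) powr (p - 1) * (a powr (1 - p) * pint f + b powr (1 - p) * pint g)"
proof -
  let ?r = "\<lambda>x. (a + b) powr (p - 1) *
    (a powr (1 - p) * cmod (f x) powr p + b powr (1 - p) * cmod (g x) powr p)"
  have fg [measurable]: "f \<in> borel_measurable M" "g \<in> borel_measurable M"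
    using f g by (auto simp: carrier_def)
  have int: "integrable M (\<lambda>x. cmod (f x) powr p)" "integrable M (\<lambda>x. cmod (g x) powr p)"
    using f g by (auto simp: carrier_def)
  have r: "integrable M ?r" using int by simp
  have le: "cmod (f x + g x) powr p \<le> ?r x" for x
    using powr_mono2[of p "cmod (f x + g x)" "cmod (f x) + cmod (g x)"] p norm_triangle_ineq[of "f x" "g x"]
      powr_add_le[OF p ab, of "cmod (f x)" "cmod (g x)"] by simp
  have i: "integrable M (\<lambda>x. cmod (f x + g x) powr p)"
    by (rule Bochner_Integration.integrable_bound[OF r]) (auto intro!: AE_I2 order_trans[OF le])
  then show "(\<lambda>x. f x + g x) \<in> carrier" by (simp add: carrier_def)
  have "pint (\<lambda>x. f x + g x) \<le> integral\<^sup>L M ?r"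
    unfolding pint_def by (intro integral_mono i r le)
  also have "\<dots> = (a + b) powr (p - 1) * (a powr (1 - p) * pint f + b powr (1 - p) * pint g)"
    using int by (simp add: pint_def)
  finally show "pint (\<lambda>x. f x + g x) \<le>
      (a + b) powr (p - 1) * (a powr (1 - p) * pint f + b powr (1 - p) * pint g)" .
qed

lemma minkowski:
  assumes f: "f \<in> carrier" and g: "g \<in> carrier"
  shows "N (\<lambda>x. f x + g x) \<le> N f + N g"
proof (rule field_le_epsilon)
  fix e :: real assume e: "0 < e"
  \<comment> \<open>The summand \<open>e / 2\<close> keeps \<open>a\<close> and \<open>b\<close>
    positive when \<open>f\<close> or \<open>g\<close> is null.\<close>
  define a where "a = N f + e / 2"
  define b where "b = N g + e / 2"
  have ab: "0 < a" "0 < b" using e by (auto simp: a_def b_def N_def add_nonneg_pos)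
  have pf: "pint f \<le> a powr p" and pg: "pint g \<le> b powr p"
    using N_le_iff[of a f] N_le_iff[of b g] ab e by (auto simp: a_def b_def)
  have "a powr (1 - p) * pint f \<le> a powr (1 - p) * a powr p"
    "b powr (1 - p) * pint g \<le> b powr (1 - p) * b powr p"
    using pf pg by (auto intro!: mult_left_mono)
  then have "a powr (1 - p) * pint f + b powr (1 - p) * pint g \<le> a + b"
    using ab by (simp add: powr_add[symmetric])
  then have "(a + b) powr (p - 1) * (a powr (1 - p) * pint f + b powr (1 - p) * pint g)
      \<le> (a + b) powr (p - 1) * (a + b)" by (intro mult_left_mono) auto
  also have "\<dots> = (a + b) powr p" using ab by (simp add: powr_diff)
  finally have "pint (\<lambda>x. f x + g x) \<le> (a + b) powr p"
    using integrable_add_powr(2)[OF f g ab] by linarith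
  then have "N (\<lambda>x. f x + g x) \<le> a + b" using N_le_iff ab by simp
  then show "N (\<lambda>x. f x + g x) \<le> N f + N g + e" by (simp add: a_def b_def)
qed

sublocale seminorm_space carrier N
proof
  fix f g :: "'a \<Rightarrow> complex" and a :: complex
  assume f: "f \<in> carrier"
  show "(\<lambda>x. a * f x) \<in> carrier" using f by (auto simp: carrier_def norm_mult powr_mult)
  show "N (\<lambda>x. a * f x) = cmod a * N f"
    using p by (simp add: N_def pint_def norm_mult powr_mult powr_powr)
  assume g: "g \<in> carrier"
  show "(\<lambda>x. f x + g x) \<in> carrier" using integrable_add_powr(1)[OF f g, of 1 1] by simp
  show "N (\<lambda>x. f x + g x) \<le> N f + N g" by (rule minkowski[OF f g])
qed

lemma nn_integral_pint: "f \<in> carrier \<Longrightarrow> (\<integral>\<^sup>+x. ennreal (cmod (f x) powr p) \<partial>M) = ennreal (pint f)"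
  unfolding pint_def by (intro nn_integral_eq_integral) (auto simp: carrier_def)

text \<open>Weighted by \<open>2 ^ n\<close>, the p-th powers of the steps have integrals at most
  \<open>((2/3) ^ n) powr p \<le> (2/3) ^ n\<close>, so their sum is finite almost everywhere. Its
  terms then tend to 0, and eventually the n-th step is below \<open>(1/2) ^ n\<close> at the given
  point.\<close>

lemma geometric_AE_convergent:
  assumes u: "\<And>n. u n \<in> carrier" and step: "\<And>n. N (\<lambda>x. u (Suc n) x - u n x) \<le> (1/3) ^ n"
  shows "AE x in M. convergent (\<lambda>n. u n x)"
proof -
  let ?d = "\<lambda>n x. cmod (u (Suc n) x - u n x)"
  have [measurable]: "u n \<in> borel_measurable M" for n using u by (auto simp: carrier_def)
  have d: "(\<lambda>x. u (Suc n) x - u n x) \<in> carrier" for n by (intro diff_closed u)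
  have "(\<integral>\<^sup>+x. (\<Sum>n. ennreal ((2 ^ n * ?d n x) powr p)) \<partial>M)
      = (\<Sum>n. \<integral>\<^sup>+x. ennreal ((2 ^ n * ?d n x) powr p) \<partial>M)"
    by (intro nn_integral_suminf) measurable
  also have "\<dots> \<le> (\<Sum>n. ennreal ((2/3) ^ n))"
  proof (intro suminf_le summableI)
    fix n
    have "(\<integral>\<^sup>+x. ennreal ((2 ^ n * ?d n x) powr p) \<partial>M)
        = ennreal ((2 ^ n) powr p) * (\<integral>\<^sup>+x. ennreal (?d n x powr p) \<partial>M)"
      by (subst nn_integral_cmult[symmetric]) (auto simp: powr_mult ennreal_mult)
    also have "\<dots> = ennreal ((2 ^ n) powr p * pint (\<lambda>x. u (Suc n) x - u n x))"
      using nn_integral_pint[OF d] pint_nonneg by (simp add: ennreal_mult)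
    also have "\<dots> \<le> ennreal ((2/3) ^ n)"
    proof (rule ennreal_leI)
      have "(2 ^ n) powr p * pint (\<lambda>x. u (Suc n) x - u n x) \<le> (2 ^ n) powr p * ((1/3) ^ n) powr p"
        using step N_le_iff by (intro mult_left_mono) auto
      also have "\<dots> = ((2/3) ^ n) powr p"
        by (simp only: powr_mult[symmetric] power_mult_distrib[symmetric]) simp
      also have "\<dots> \<le> (2/3) ^ n" using p by (intro powr_le_one_le) (auto simp: power_le_one)
      finally show "(2 ^ n) powr p * pint (\<lambda>x. u (Suc n) x - u n x) \<le> (2/3) ^ n" .
    qed
    finally show "(\<integral>\<^sup>+x. ennreal ((2 ^ n * ?d n x) powr p) \<partial>M) \<le> ennreal ((2/3) ^ n)" .
  qed
  also have "\<dots> = ennreal (\<Sum>n. (2/3) ^ n)" by (intro suminf_ennreal2) (auto intro: summable_geometric)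
  also have "\<dots> < \<infinity>" by simp
  finally have "(\<integral>\<^sup>+x. (\<Sum>n. ennreal ((2 ^ n * ?d n x) powr p)) \<partial>M) \<noteq> \<infinity>"
    by simp
  then have "AE x in M. (\<Sum>n. ennreal ((2 ^ n * ?d n x) powr p)) \<noteq> \<infinity>"
    by (intro nn_integral_PInf_AE) measurable
  then show ?thesis
  proof eventually_elim
    case (elim x)
    then have "summable (\<lambda>n. (2 ^ n * ?d n x) powr p)"
      by (intro summable_suminf_not_top) auto
    then have "eventually (\<lambda>n. (2 ^ n * ?d n x) powr p < 1) sequentially"
      by (intro order_tendstoD(2)[OF summable_LIMSEQ_zero]) auto
    then have "eventually (\<lambda>n. norm (u (Suc n) x - u n x) \<le> (1/2) ^ n) sequentially"
    proof eventually_elim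
      case (elim n)
      have "2 ^ n * ?d n x \<le> 1"
        using elim ge_one_powr_ge_zero[of "2 ^ n * ?d n x" p] p by (intro leI notI) auto
      then show ?case by (simp add: field_simps)
    qed
    then have "summable (\<lambda>n. u (Suc n) x - u n x)"
      by (intro summable_comparison_test_ev[OF _ summable_geometric[of "1/2 :: real"]]) auto
    then have "convergent (\<lambda>n. u 0 x + (\<Sum>k<n. u (Suc k) x - u k x))"
      by (intro convergent_add convergent_const) (simp add: summable_iff_convergent)
    then show ?case by (simp add: sum_lessThan_telescope[of "\<lambda>n. u n x"])
  qed
qed

sublocale complete_seminorm carrier N
proof
  fix u assume u: "\<And>n. u n \<in> carrier" and step: "\<And>n. N (\<lambda>x. u (Suc n) x - u n x) \<le> (1/3) ^ n"
  have m [measurable]: "u n \<in> borel_measurable M" for n using u by (auto simp: carrier_def)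
  \<comment> \<open>Where the sequence diverges \<open>lim\<close> is an arbitrary value;
    \<open>y\<close> is measurable all the same, and the set of such points is null.\<close>
  define y where "y = (\<lambda>x. lim (\<lambda>n. u n x))"
  have y [measurable]: "y \<in> borel_measurable M"
    unfolding y_def by (rule borel_measurable_lim_metric) measurable
  have lim: "AE x in M. (\<lambda>n. u n x) \<longlonglongrightarrow> y x"
    using geometric_AE_convergent[OF u step] unfolding y_def by eventually_elim (simp add: convergent_LIMSEQ_iff)
  \<comment> \<open>Fatou's lemma, applied in k to \<open>u (n + k) - u n\<close>, yields
    integrability and the rate together. Membership of \<open>y\<close> follows by adding
    \<open>u 0\<close> to \<open>y - u 0\<close>.\<close>
  have bound: "(\<lambda>x. y x - u n x) \<in> carrier \<and> N (\<lambda>x. y x - u n x) \<le> 3/2 * (1/3) ^ n" for n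
  proof -
    let ?c = "3/2 * (1/3) ^ n :: real"
    have "(\<integral>\<^sup>+x. ennreal (cmod (y x - u n x) powr p) \<partial>M) =
        (\<integral>\<^sup>+x. liminf (\<lambda>k. ennreal (cmod (u (n + k) x - u n x) powr p)) \<partial>M)"
    proof (rule nn_integral_cong_AE, use lim in eventually_elim)
      fix x assume "(\<lambda>k. u k x) \<longlonglongrightarrow> y x"
      then have "(\<lambda>k. u (n + k) x) \<longlonglongrightarrow> y x"
        using LIMSEQ_ignore_initial_segment[of "\<lambda>k. u k x" "y x" n] by (simp add: add.commute)
      then have "(\<lambda>k. ennreal (cmod (u (n + k) x - u n x) powr p)) \<longlonglongrightarrow>
          ennreal (cmod (y x - u n x) powr p)"
        using p by (intro tendsto_ennrealI tendsto_powr' tendsto_norm tendsto_diff tendsto_const) auto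
      then show "ennreal (cmod (y x - u n x) powr p) =
          liminf (\<lambda>k. ennreal (cmod (u (n + k) x - u n x) powr p))"
        by (intro lim_imp_Liminf[symmetric]) auto
    qed
    also have "\<dots> \<le> liminf (\<lambda>k. \<integral>\<^sup>+x. ennreal (cmod (u (n + k) x - u n x) powr p) \<partial>M)"
      by (intro nn_integral_liminf) measurable
    also have "\<dots> \<le> liminf (\<lambda>k. ennreal (?c powr p))"
    proof (intro Liminf_mono always_eventually allI)
      fix k
      have "?c * (1 - (1/3) ^ k) \<le> ?c * 1" by (intro mult_left_mono) auto
      then have "N (\<lambda>x. u (n + k) x - u n x) \<le> ?c"
        using geometric_dist_le[OF u step, of n k] by linarith
      then show "(\<integral>\<^sup>+x. ennreal (cmod (u (n + k) x - u n x) powr p) \<partial>M) \<le> ennreal (?c powr p)"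
        using nn_integral_pint[OF diff_closed[OF u u]] N_le_iff[of ?c] by (simp add: ennreal_leI)
    qed
    finally have le: "(\<integral>\<^sup>+x. ennreal (cmod (y x - u n x) powr p) \<partial>M) \<le> ennreal (?c powr p)"
      by (simp add: Liminf_const)
    then have "integrable M (\<lambda>x. cmod (y x - u n x) powr p)"
      by (intro integrableI_nonneg) (auto simp: le_less_trans)
    then have c: "(\<lambda>x. y x - u n x) \<in> carrier" by (simp add: carrier_def)
    moreover have "pint (\<lambda>x. y x - u n x) \<le> ?c powr p"
      using le nn_integral_pint[OF c] by simp
    ultimately show ?thesis using N_le_iff[of ?c] by simp
  qed
  have "y \<in> carrier" using add_closed[OF conjunct1[OF bound[of 0]] u[of 0]] by simp
  moreover have "(\<lambda>n. N (\<lambda>x. y x - u n x)) \<longlonglongrightarrow> 0"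
  proof (rule tendsto_sandwich[OF _ _ tendsto_const])
    have "(\<lambda>n. 3/2 * (1/3::real) ^ n) \<longlonglongrightarrow> 3/2 * 0"
      by (intro tendsto_mult tendsto_const LIMSEQ_power_zero) auto
    then show "(\<lambda>n. 3/2 * (1/3::real) ^ n) \<longlonglongrightarrow> 0" by simp
  qed (use bound in \<open>auto simp: N_def\<close>)
  ultimately show "\<exists>y\<in>carrier. (\<lambda>n. N (\<lambda>x. y x - u n x)) \<longlonglongrightarrow> 0" by blast
qed

end

lemma complete_seminorm_Lp:
  "1 \<le> p \<Longrightarrow> complete_seminorm (carr G (Lp p)) (snorm G (Lp p))"
proof -
  assume "1 \<le> p"
  then interpret lp_space "graph_measure G" p by unfold_locales
  have "carrier = carr G (Lp p)" "N = snorm G (Lp p)"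
    by (auto simp: carrier_def N_def pint_def fun_eq_iff)
  then show ?thesis using complete_seminorm_axioms by simp
qed

text \<open>Serves \<open>C0\<close> and \<open>BUC\<close> together: what they share is boundedness
  on \<open>P\<close>, which makes the suprema meaningful, and closure under uniform approximation
  on \<open>P\<close>.\<close>

lemma complete_seminorm_sup:
  fixes X :: "('a \<Rightarrow> complex) set"
  assumes P: "P \<noteq> {}"
    and add: "\<And>f g. f \<in> X \<Longrightarrow> g \<in> X \<Longrightarrow> (\<lambda>x. f x + g x) \<in> X"
    and scale: "\<And>f a. f \<in> X \<Longrightarrow> (\<lambda>x. a * f x) \<in> X"
    and bounded: "\<And>f. f \<in> X \<Longrightarrow> bounded (f ` P)"
    and closed: "\<And>f. (\<And>e. 0 < e \<Longrightarrow> \<exists>g\<in>X. \<forall>x\<in>P. cmod (f x - g x) < e) \<Longrightarrow> f \<in> X"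
  shows "complete_seminorm X (\<lambda>f. SUP x\<in>P. cmod (f x))"
proof -
  have bdd: "bdd_above ((\<lambda>x. cmod (f x)) ` P)" if "f \<in> X" for f
    using bounded[OF that] by (auto simp: bounded_iff bdd_above_def)
  have up: "cmod (f x) \<le> (SUP x\<in>P. cmod (f x))" if "f \<in> X" "x \<in> P" for f x
    by (intro cSUP_upper bdd that)
  interpret seminorm_space X "\<lambda>f. SUP x\<in>P. cmod (f x)"
  proof
    fix f g :: "'a \<Rightarrow> complex" and a :: complex
    assume f: "f \<in> X"
    show "(SUP x\<in>P. cmod (a * f x)) = cmod a * (SUP x\<in>P. cmod (f x))"
    proof (rule antisym)
      show "(SUP x\<in>P. cmod (a * f x)) \<le> cmod a * (SUP x\<in>P. cmod (f x))"
        using up[OF f] by (intro cSUP_least P) (auto simp: norm_mult intro!: mult_left_mono)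
      show "cmod a * (SUP x\<in>P. cmod (f x)) \<le> (SUP x\<in>P. cmod (a * f x))"
      proof (cases "a = 0")
        case False
        have "(SUP x\<in>P. cmod (f x)) \<le> (SUP x\<in>P. cmod (a * f x)) / cmod a"
          using up[OF scale[OF f, of a]] False
          by (intro cSUP_least P) (simp add: norm_mult field_simps)
        then show ?thesis using False by (simp add: field_simps)
      qed (use P in simp)
    qed
    assume g: "g \<in> X"
    show "(SUP x\<in>P. cmod (f x + g x)) \<le> (SUP x\<in>P. cmod (f x)) + (SUP x\<in>P. cmod (g x))"
      using up[OF f] up[OF g]
      by (intro cSUP_least P) (meson add_mono norm_triangle_ineq order_trans)
  qed (use add scale in auto)
  show ?thesis
  proof
    fix u assume u: "\<And>n. u n \<in> X"
      and step: "\<And>n. (SUP x\<in>P. cmod (u (Suc n) x - u n x)) \<le> (1/3) ^ n"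
    have c: "\<And>n. 3/2 * (1/3) ^ n * (1 - (1/3) ^ k) \<le> 3/2 * (1/3::real) ^ n" for k
      by (intro mult_left_le) auto
    have dist: "cmod (u (n + k) x - u n x) \<le> 3/2 * (1/3) ^ n" if "x \<in> P" for x n k
      using up[OF diff_closed[OF u u] that, of "n + k" n] geometric_dist_le[OF u step, of n k] c[of n k]
      by linarith
    have c0: "(\<lambda>n. 3/2 * (1/3::real) ^ n) \<longlonglongrightarrow> 0"
      using tendsto_mult[OF tendsto_const[of "3/2::real"] LIMSEQ_power_zero[of "1/3::real"]] by simp
    define y where "y = (\<lambda>x. lim (\<lambda>n. u n x))"
    have lim: "(\<lambda>n. u n x) \<longlonglongrightarrow> y x" if x: "x \<in> P" for x
    proof -
      have "Cauchy (\<lambda>n. u n x)"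
      proof (rule metric_CauchyI)
        fix e :: real assume "0 < e"
        then have "eventually (\<lambda>n. 3/2 * (1/3::real) ^ n < e / 2) sequentially"
          by (intro order_tendstoD(2)[OF c0]) auto
        then obtain n where n: "3/2 * (1/3::real) ^ n < e / 2" by (auto simp: eventually_sequentially)
        have "dist (u k x) (u n x) < e / 2" if "k \<ge> n" for k
          using dist[OF x, of n "k - n"] that n by (simp add: dist_norm)
        then have "dist (u k x) (u l x) < e" if "k \<ge> n" "l \<ge> n" for k l
          using that by (metis dist_triangle_half_l)
        then show "\<exists>n. \<forall>k\<ge>n. \<forall>l\<ge>n. dist (u k x) (u l x) < e" by blast
      qed
      then show ?thesis unfolding y_def by (simp add: Cauchy_convergent convergent_LIMSEQ_iff[symmetric])
    qed
    have bound: "cmod (y x - u n x) \<le> 3/2 * (1/3) ^ n" if x: "x \<in> P" for x n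
    proof (rule LIMSEQ_le_const2)
      show "(\<lambda>k. cmod (u (k + n) x - u n x)) \<longlonglongrightarrow> cmod (y x - u n x)"
        by (intro tendsto_norm tendsto_diff tendsto_const LIMSEQ_ignore_initial_segment lim x)
      show "\<exists>K. \<forall>k\<ge>K. cmod (u (k + n) x - u n x) \<le> 3/2 * (1/3) ^ n"
        using dist[OF x, of n] by (simp add: add.commute)
    qed
    have y: "y \<in> X"
    proof (rule closed)
      fix e :: real assume "0 < e"
      then have "eventually (\<lambda>n. 3/2 * (1/3::real) ^ n < e) sequentially"
        by (intro order_tendstoD(2)[OF c0]) auto
      then obtain n where "3/2 * (1/3::real) ^ n < e" by (auto simp: eventually_sequentially)
      then have "\<forall>x\<in>P. cmod (y x - u n x) < e" using bound le_less_trans by blast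
      then show "\<exists>g\<in>X. \<forall>x\<in>P. cmod (y x - g x) < e" using u by blast
    qed
    have "(\<lambda>n. SUP x\<in>P. cmod (y x - u n x)) \<longlonglongrightarrow> 0"
      by (rule tendsto_sandwich[OF _ _ tendsto_const c0])
        (auto simp del: times_divide_eq_left
          intro!: eventuallyI N_nonneg diff_closed y u cSUP_least P bound)
    with y show "\<exists>y\<in>X. (\<lambda>n. SUP x\<in>P. cmod (y x - u n x)) \<longlonglongrightarrow> 0" by blast
  qed
qed

section \<open>Completeness of \<open>C0\<close> and \<open>BUC\<close>\<close>

context metric_graph
begin

lemma points_nonempty: "points G \<noteq> {}"
  using has_edge edge_pt_in_points[of _ 0] len_pos by fastforce

lemma continuous_map_uniformly_approximable:
  fixes f :: "('v, 'e) gpoint \<Rightarrow> complex"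
  assumes "\<And>e. 0 < e \<Longrightarrow> \<exists>g\<in>X. \<forall>x\<in>points G. cmod (f x - g x) < e"
    and "\<And>g. g \<in> X \<Longrightarrow> continuous_map (mtopology_of (path_metric G)) euclidean g"
  shows "continuous_map (mtopology_of (path_metric G)) euclidean f"
proof -
  have "\<exists>g\<in>X. \<forall>x\<in>points G. cmod (f x - g x) < 1 / real (Suc n)" for n
    using assms(1) by simp
  then obtain g where g: "\<And>n. g n \<in> X" "\<And>n x. x \<in> points G \<Longrightarrow> cmod (f x - g n x) < 1 / real (Suc n)"
    by metis
  have "continuous_map (mtopology_of (path_metric G)) Met_TC.mtopology f"
  proof (rule Met_TC.continuous_map_uniform_limit)
    show "\<forall>\<^sub>F n in sequentially. continuous_map (mtopology_of (path_metric G)) Met_TC.mtopology (g n)"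
      using assms(2) g(1) by simp
    fix e :: real assume "0 < e"
    then have "eventually (\<lambda>n. inverse (real (Suc n)) < e) sequentially"
      by (intro order_tendstoD(2)[OF LIMSEQ_inverse_real_of_nat])
    then show "\<forall>\<^sub>F n in sequentially. \<forall>x\<in>topspace (mtopology_of (path_metric G)).
        f x \<in> UNIV \<and> dist (g n x) (f x) < e"
    proof eventually_elim
      case (elim n)
      then show ?case using g(2)[of _ n]
        by (auto simp: dist_norm norm_minus_commute inverse_eq_divide intro: less_trans)
    qed
  qed simp
  then show ?thesis by simp
qed

text \<open>Boundedness is not part of the definition of \<open>C0\<close>: the function is below 1
  off a compact set and has a compact image on it.\<close>

lemma carr_C0_bounded:
  assumes "f \<in> carr G C0" shows "bounded (f ` points G)"
proof -
  obtain K where K: "compactin (mtopology_of (path_metric G)) K" "\<And>x. x \<in> points G - K \<Longrightarrow> cmod (f x) < 1"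
    and f: "continuous_map (mtopology_of (path_metric G)) euclidean f"
    using assms by (auto dest: spec[of _ 1])
  have "bounded (f ` K)" using image_compactin[OF K(1) f] by (simp add: compact_imp_bounded)
  then obtain B where B: "\<And>x. x \<in> K \<Longrightarrow> cmod (f x) \<le> B" by (auto simp: bounded_iff)
  have "cmod (f x) \<le> max B 1" if "x \<in> points G" for x
    using B[of x] K(2)[of x] that by (cases "x \<in> K") auto
  then show ?thesis by (auto simp: bounded_iff)
qed

lemma complete_seminorm_C0: "complete_seminorm (carr G C0) (snorm G C0)"
proof -
  let ?T = "mtopology_of (path_metric G)"
  have cont: "f \<in> carr G C0 \<Longrightarrow> continuous_map ?T euclidean f" for f :: "('v, 'e) gpoint \<Rightarrow> complex"
    by simp
  have vanish: "\<exists>K. compactin ?T K \<and> (\<forall>x\<in>points G - K. cmod (f x) < e)" if "f \<in> carr G C0" "0 < e" for f e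
    using that by simp
  have "snorm G C0 = (\<lambda>f. SUP x\<in>points G. cmod (f x))" by (simp add: fun_eq_iff)
  moreover have "complete_seminorm (carr G C0) (\<lambda>f. SUP x\<in>points G. cmod (f x))"
  proof (rule complete_seminorm_sup[OF points_nonempty])
    fix f assume f: "f \<in> carr G C0"
    then show "bounded (f ` points G)" by (rule carr_C0_bounded)
    fix a :: complex
    show "(\<lambda>x. a * f x) \<in> carr G C0"
    proof (simp, intro conjI allI impI)
      show "continuous_map ?T euclidean (\<lambda>x. a * f x)"
        using continuous_map_compose[OF cont[OF f], of euclidean "\<lambda>z. a * z"]
        by (simp add: o_def continuous_intros)
      fix e :: real assume e: "0 < e"
      have "0 < e / (cmod a + 1)" using e by (intro divide_pos_pos) (auto intro: add_nonneg_pos)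
      then obtain K where K: "compactin ?T K" "\<And>x. x \<in> points G - K \<Longrightarrow> cmod (f x) < e / (cmod a + 1)"
        using vanish[OF f] by blast
      have "cmod (a * f x) < e" if x: "x \<in> points G - K" for x
      proof -
        have "cmod (a * f x) \<le> (cmod a + 1) * cmod (f x)" by (simp add: norm_mult distrib_right)
        also have "\<dots> < e" using K(2)[OF x] by (simp add: pos_less_divide_eq add_nonneg_pos mult.commute)
        finally show ?thesis .
      qed
      with K(1) show "\<exists>K. compactin ?T K \<and> (\<forall>x\<in>points G - K. cmod (a * f x) < e)" by blast
    qed
  next
    fix f g assume f: "f \<in> carr G C0" and g: "g \<in> carr G C0"
    show "(\<lambda>x. f x + g x) \<in> carr G C0"
    proof (simp, intro conjI allI impI)
      show "continuous_map ?T euclidean (\<lambda>x. f x + g x)"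
        using cont[OF f] cont[OF g] by (intro continuous_map_add) auto
      fix e :: real assume e: "0 < e"
      obtain K where K: "compactin ?T K" "\<And>x. x \<in> points G - K \<Longrightarrow> cmod (f x) < e / 2"
        using vanish[OF f, of "e / 2"] e by auto
      obtain L where L: "compactin ?T L" "\<And>x. x \<in> points G - L \<Longrightarrow> cmod (g x) < e / 2"
        using vanish[OF g, of "e / 2"] e by auto
      have "cmod (f x + g x) < e" if "x \<in> points G - (K \<union> L)" for x
        using K(2)[of x] L(2)[of x] that norm_triangle_ineq[of "f x" "g x"] by simp
      then show "\<exists>K. compactin ?T K \<and> (\<forall>x\<in>points G - K. cmod (f x + g x) < e)"
        using compactin_Un[OF K(1) L(1)] by blast
    qed
  next
    fix f :: "('v, 'e) gpoint \<Rightarrow> complex"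
    assume ap: "\<And>e. 0 < e \<Longrightarrow> \<exists>g\<in>carr G C0. \<forall>x\<in>points G. cmod (f x - g x) < e"
    show "f \<in> carr G C0"
    proof (simp, intro conjI allI impI)
      show "continuous_map ?T euclidean f"
        using continuous_map_uniformly_approximable[OF ap cont] by blast
      fix e :: real assume e: "0 < e"
      obtain g where g: "g \<in> carr G C0" "\<And>x. x \<in> points G \<Longrightarrow> cmod (f x - g x) < e / 2"
        using ap[of "e / 2"] e by auto
      obtain K where K: "compactin ?T K" "\<And>x. x \<in> points G - K \<Longrightarrow> cmod (g x) < e / 2"
        using vanish[OF g(1), of "e / 2"] e by auto
      have "cmod (f x) < e" if "x \<in> points G - K" for x
        using K(2)[of x] g(2)[of x] that norm_triangle_ineq[of "f x - g x" "g x"] by simp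
      with K(1) show "\<exists>K. compactin ?T K \<and> (\<forall>x\<in>points G - K. cmod (f x) < e)" by blast
    qed
  qed
  ultimately show ?thesis by simp
qed

lemma uniformly_continuous_map_graph_iff:
  "uniformly_continuous_map (path_metric G) euclidean_metric f \<longleftrightarrow>
    (\<forall>e>0. \<exists>d>0. \<forall>x\<in>points G. \<forall>y\<in>points G. path_dist G y x < d \<longrightarrow> dist (f y) (f x) < e)"
  by (simp add: uniformly_continuous_map_def)

lemma complete_seminorm_BUC: "complete_seminorm (carr G BUC) (snorm G BUC)"
proof -
  have uc: "\<exists>d>0. \<forall>x\<in>points G. \<forall>y\<in>points G. path_dist G y x < d \<longrightarrow> dist (f y) (f x) < e"
    if "f \<in> carr G BUC" "0 < e" for f e
    using that by (simp add: uniformly_continuous_map_graph_iff)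
  have bd: "bounded (f ` points G)" if "f \<in> carr G BUC" for f using that by simp
  have "snorm G BUC = (\<lambda>f. SUP x\<in>points G. cmod (f x))" by (simp add: fun_eq_iff)
  moreover have "complete_seminorm (carr G BUC) (\<lambda>f. SUP x\<in>points G. cmod (f x))"
  proof (rule complete_seminorm_sup[OF points_nonempty _ _ bd])
    fix f and a :: complex assume f: "f \<in> carr G BUC"
    show "(\<lambda>x. a * f x) \<in> carr G BUC"
    proof (simp add: uniformly_continuous_map_graph_iff, intro conjI allI impI)
      fix e :: real assume e: "0 < e"
      have "0 < e / (cmod a + 1)" using e by (intro divide_pos_pos) (auto intro: add_nonneg_pos)
      then obtain d where d: "d > 0" "\<And>x y. x \<in> points G \<Longrightarrow> y \<in> points G \<Longrightarrow>
          path_dist G y x < d \<Longrightarrow> dist (f y) (f x) < e / (cmod a + 1)" using uc[OF f] by blast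
      have "dist (a * f y) (a * f x) < e"
        if xy: "x \<in> points G" "y \<in> points G" "path_dist G y x < d" for x y
      proof -
        have "dist (a * f y) (a * f x) \<le> (cmod a + 1) * dist (f y) (f x)"
          by (simp add: dist_norm norm_mult right_diff_distrib[symmetric] distrib_right)
        also have "\<dots> < e" using d(2)[OF xy] by (simp add: pos_less_divide_eq add_nonneg_pos mult.commute)
        finally show ?thesis .
      qed
      with d(1) show "\<exists>d>0. \<forall>x\<in>points G. \<forall>y\<in>points G. path_dist G y x < d \<longrightarrow>
          dist (a * f y) (a * f x) < e" by blast
    next
      show "bounded ((\<lambda>x. a * f x) ` points G)"
        using bounded_linear_image[OF bd[OF f] bounded_linear_mult_right[of a]] by (simp add: image_image)
    qed
  next
    fix f g assume f: "f \<in> carr G BUC" and g: "g \<in> carr G BUC"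
    show "(\<lambda>x. f x + g x) \<in> carr G BUC"
    proof (simp add: uniformly_continuous_map_graph_iff, intro conjI allI impI)
      fix e :: real assume e: "0 < e"
      obtain d where d: "d > 0" "\<And>x y. x \<in> points G \<Longrightarrow> y \<in> points G \<Longrightarrow>
          path_dist G y x < d \<Longrightarrow> dist (f y) (f x) < e / 2" using uc[OF f, of "e/2"] e by auto
      obtain d' where d': "d' > 0" "\<And>x y. x \<in> points G \<Longrightarrow> y \<in> points G \<Longrightarrow>
          path_dist G y x < d' \<Longrightarrow> dist (g y) (g x) < e / 2" using uc[OF g, of "e/2"] e by auto
      have "dist (f y + g y) (f x + g x) < e"
        if "x \<in> points G" "y \<in> points G" "path_dist G y x < min d d'" for x y
        using d(2)[of x y] d'(2)[of x y] that dist_triangle_add[of "f y" "g y" "f x" "g x"] by simp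
      then show "\<exists>d>0. \<forall>x\<in>points G. \<forall>y\<in>points G. path_dist G y x < d \<longrightarrow>
          dist (f y + g y) (f x + g x) < e" using d(1) d'(1) by (intro exI[of _ "min d d'"]) auto
    next
      show "bounded ((\<lambda>x. f x + g x) ` points G)"
        using bounded_plus_comp[OF bd[OF f] bd[OF g]] .
    qed
  next
    fix f :: "('v, 'e) gpoint \<Rightarrow> complex"
    assume ap: "\<And>e. 0 < e \<Longrightarrow> \<exists>g\<in>carr G BUC. \<forall>x\<in>points G. cmod (f x - g x) < e"
    show "f \<in> carr G BUC"
    proof (simp add: uniformly_continuous_map_graph_iff, intro conjI allI impI)
      fix e :: real assume e: "0 < e"
      obtain g where g: "g \<in> carr G BUC" "\<And>x. x \<in> points G \<Longrightarrow> dist (f x) (g x) < e / 3"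
        using ap[of "e / 3"] e by (auto simp: dist_norm)
      obtain d where d: "d > 0" "\<And>x y. x \<in> points G \<Longrightarrow> y \<in> points G \<Longrightarrow>
          path_dist G y x < d \<Longrightarrow> dist (g y) (g x) < e / 3" using uc[OF g(1), of "e/3"] e by auto
      have "dist (f y) (f x) < e"
        if "x \<in> points G" "y \<in> points G" "path_dist G y x < d" for x y
        using g(2)[of x] g(2)[of y] d(2)[of x y] that
          dist_triangle[of "f y" "f x" "g y"] dist_triangle[of "g y" "f x" "g x"]
        by (simp add: dist_commute[of "f x" "g x"])
      with d(1) show "\<exists>d>0. \<forall>x\<in>points G. \<forall>y\<in>points G. path_dist G y x < d \<longrightarrow>
          dist (f y) (f x) < e" by blast
    next
      obtain g where g: "g \<in> carr G BUC" "\<And>x. x \<in> points G \<Longrightarrow> cmod (f x - g x) < 1"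
        using ap[of 1] by auto
      obtain B where B: "\<And>x. x \<in> points G \<Longrightarrow> cmod (g x) \<le> B"
        using bd[OF g(1)] by (auto simp: bounded_iff)
      have "cmod (f x) \<le> B + 1" if "x \<in> points G" for x
        using g(2)[OF that] B[OF that] norm_triangle_ineq[of "f x - g x" "g x"] by simp
      then show "bounded (f ` points G)" by (auto simp: bounded_iff)
    qed
  qed
  ultimately show ?thesis by simp
qed

end

section \<open>Geometry and growth of the graph\<close>

primrec reach :: "('v, 'e) mgraph \<Rightarrow> 'v \<Rightarrow> nat \<Rightarrow> 'v set" where
  "reach G v 0 = {v}"
| "reach G v (Suc n) = reach G v n \<union>
    (\<Union>w\<in>reach G v n. tail (skel G) ` incident G w \<union> head (skel G) ` incident G w)"

abbreviation vdist :: "('v, 'e) mgraph \<Rightarrow> 'v \<Rightarrow> 'v \<Rightarrow> real" where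
  "vdist G v w \<equiv> path_dist G (Vertex v) (Vertex w)"

context metric_graph
begin

lemma reach_mono: "n \<le> k \<Longrightarrow> reach G v n \<subseteq> reach G v k"
  by (rule lift_Suc_mono_le[of "reach G v"]) auto

lemma reach_verts: "v \<in> verts (skel G) \<Longrightarrow> reach G v n \<subseteq> verts (skel G)"
  by (induction n) (auto simp: incident_def)

lemma finite_incident: "w \<in> verts (skel G) \<Longrightarrow> finite (incident G w)"
  using locally_finite by blast

lemma finite_reach: "v \<in> verts (skel G) \<Longrightarrow> finite (reach G v n)"
  by (induction n) (use reach_verts finite_incident in fastforce)+

lemma reach_edge:
  assumes "e \<in> arcs (skel G)"
  shows "tail (skel G) e \<in> reach G v n \<Longrightarrow> head (skel G) e \<in> reach G v (Suc n)"
    and "head (skel G) e \<in> reach G v n \<Longrightarrow> tail (skel G) e \<in> reach G v (Suc n)"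
  using assms by (auto simp: incident_def)

text \<open>Crossing an edge from end to end costs at least \<open>l\<close>, so length
  \<open>L\<close> pays for at most \<open>L / l\<close> crossings. At an inner point the invariant
  records an end of the edge that has been reached and the length spent beyond it; a crossing is
  credited only on arrival at the other end.\<close>

lemma gpath_reach:
  assumes path: "gpath G (Vertex v) q L" and l: "\<And>e. e \<in> arcs (skel G) \<Longrightarrow> l \<le> len G e"
  shows "\<exists>n. real n * l \<le> L \<and> (case q of Vertex w \<Rightarrow> w \<in> reach G v n
    | Inner e x \<Rightarrow> tail (skel G) e \<in> reach G v n \<and> real n * l + x \<le> L \<or>
        head (skel G) e \<in> reach G v n \<and> real n * l + (len G e - x) \<le> L)"
  using path
proof (induction rule: gpath.induct)
  case refl
  then show ?case by (intro exI[of _ 0]) auto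
next
  case (step e x L y)
  have e: "0 < len G e" "l \<le> len G e" using len_pos l step.hyps by auto
  \<comment> \<open>A vertex written as an end of \<open>e\<close> has distance 0 from that end
    along \<open>e\<close>, so one form covers vertices and inner points.\<close>
  have "\<exists>n. tail (skel G) e \<in> reach G v n \<and> real n * l + x \<le> L \<or>
      head (skel G) e \<in> reach G v n \<and> real n * l + (len G e - x) \<le> L"
    using step.IH by (auto simp: edge_pt_def split: if_splits)
  then obtain n where n: "tail (skel G) e \<in> reach G v n \<and> real n * l + x \<le> L \<or>
      head (skel G) e \<in> reach G v n \<and> real n * l + (len G e - x) \<le> L" by blast
  let ?L = "L + \<bar>x - y\<bar>"
  from n have "tail (skel G) e \<in> reach G v n \<and> real n * l + y \<le> ?L \<or>
      head (skel G) e \<in> reach G v n \<and> real n * l + (len G e - y) \<le> ?L" by auto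
  then show ?case
  proof
    assume a: "tail (skel G) e \<in> reach G v n \<and> real n * l + y \<le> ?L"
    \<comment> \<open>On arrival at the head the length spent on \<open>e\<close> is at least
      \<open>l\<close>, which pays for the increase of \<open>n\<close>.\<close>
    have "y = len G e \<Longrightarrow> real (Suc n) * l \<le> ?L" using a e by (simp add: algebra_simps)
    then show ?thesis
      using a e step.hyps reach_edge(1)[OF step.hyps(2), of v n]
      by (cases "y = len G e") (auto simp: edge_pt_def simp del: reach.simps intro: exI[of _ n] exI[of _ "Suc n"])
  next
    assume a: "head (skel G) e \<in> reach G v n \<and> real n * l + (len G e - y) \<le> ?L"
    have "y = 0 \<Longrightarrow> real (Suc n) * l \<le> ?L" using a e by (simp add: algebra_simps)
    then show ?thesis
      using a e step.hyps reach_edge(2)[OF step.hyps(2), of v n]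
      by (cases "y = 0") (auto simp: edge_pt_def simp del: reach.simps intro: exI[of _ n] exI[of _ "Suc n"])
  qed
qed

text \<open>\<open>card\<close> is 0 on infinite sets, so comparing the counts in
  \<open>edges_in_ball\<close> requires this. An edge meeting the ball has an end within
  \<open>r / l\<close> crossings of \<open>v\<close>, and by local finiteness there are finitely
  many such edges.\<close>

lemma finite_edges_near:
  assumes v: "v \<in> verts (skel G)"
  shows "finite {e \<in> arcs (skel G). \<exists>x. 0 < x \<and> x < len G e \<and> path_dist G (Vertex v) (Inner e x) < r}"
    (is "finite ?A")
proof -
  obtain l where l: "0 < l" "\<And>e. e \<in> arcs (skel G) \<Longrightarrow> l \<le> len G e" using len_bounds by blast
  obtain N where N: "r / l < real N" using reals_Archimedean2 by blast
  have "?A \<subseteq> (\<Union>w\<in>reach G v N. incident G w)"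
  proof
    fix e assume "e \<in> ?A"
    then obtain x where e: "e \<in> arcs (skel G)" "0 < x" "x < len G e"
      "path_dist G (Vertex v) (Inner e x) < r" by auto
    then have "Vertex v \<in> points G" "Inner e x \<in> points G" using v by (auto simp: points_def)
    then obtain L where L: "L < r" "gpath G (Vertex v) (Inner e x) L" using path_dist_less e(4) by blast
    obtain n where n: "real n * l \<le> L" "tail (skel G) e \<in> reach G v n \<or> head (skel G) e \<in> reach G v n"
      using gpath_reach[OF L(2) l(2)] by auto
    have "r < real N * l" using N l(1) by (simp add: field_simps)
    with n(1) L(1) have "real n * l < real N * l" by linarith
    then have "n \<le> N" using l(1) by simp
    with n(2) reach_mono have "tail (skel G) e \<in> reach G v N \<or> head (skel G) e \<in> reach G v N" by blast
    then show "e \<in> (\<Union>w\<in>reach G v N. incident G w)" using e(1) by (auto simp: incident_def)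
  qed
  moreover have "finite (\<Union>w\<in>reach G v N. incident G w)"
    using finite_reach[OF v] reach_verts[OF v] finite_incident by blast
  ultimately show ?thesis by (rule finite_subset)
qed

lemma Vertex_in_points [simp]: "Vertex w \<in> points G \<longleftrightarrow> w \<in> verts (skel G)"
  by (auto simp: points_def)

lemma Inner_in_points [simp]: "Inner e x \<in> points G \<longleftrightarrow> e \<in> arcs (skel G) \<and> 0 < x \<and> x < len G e"
  by (auto simp: points_def)

lemma path_dist_edge_le:
  "e \<in> arcs (skel G) \<Longrightarrow> x \<in> {0..len G e} \<Longrightarrow> y \<in> {0..len G e} \<Longrightarrow>
    path_dist G (edge_pt G e x) (edge_pt G e y) \<le> \<bar>x - y\<bar>"
  by (intro path_dist_le gpath_edge)

lemma path_dist_tail_le: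
  assumes e: "e \<in> arcs (skel G)" and x: "x \<in> {0..len G e}" and v: "v \<in> verts (skel G)"
  shows "path_dist G (Vertex v) (edge_pt G e x) \<le> vdist G v (tail (skel G) e) + x"
proof -
  have "path_dist G (edge_pt G e 0) (edge_pt G e x) \<le> x"
    using path_dist_edge_le[OF e _ x, of 0] x by auto
  then show ?thesis
    using path_dist_triangle[of "Vertex v" "edge_pt G e 0" "edge_pt G e x"] v x
      edge_pt_in_points[OF e, of 0] edge_pt_in_points[OF e x] by (simp add: edge_pt_def)
qed

lemma vdist_edge_diff:
  assumes e: "e \<in> arcs (skel G)" and v: "v \<in> verts (skel G)"
  shows "\<bar>vdist G v (head (skel G) e) - vdist G v (tail (skel G) e)\<bar> \<le> len G e"
proof -
  have l: "0 < len G e" by (rule len_pos[OF e])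
  have h: "edge_pt G e (len G e) = Vertex (head (skel G) e)" "edge_pt G e 0 = Vertex (tail (skel G) e)"
    using l by (auto simp: edge_pt_def)
  have "path_dist G (Vertex (head (skel G) e)) (Vertex (tail (skel G) e)) \<le> len G e"
    using path_dist_edge_le[OF e, of "len G e" 0] l by (simp add: h)
  then show ?thesis
    using path_dist_tail_le[OF e _ v, of "len G e"] l
      path_dist_triangle[of "Vertex v" "Vertex (head (skel G) e)" "Vertex (tail (skel G) e)"] v e
    by (simp add: h)
qed

lemma finite_edges_vdist_le:
  assumes v: "v \<in> verts (skel G)"
  shows "finite {e \<in> arcs (skel G). vdist G v (tail (skel G) e) \<le> r}"
proof -
  obtain u where u: "\<And>e. e \<in> arcs (skel G) \<Longrightarrow> len G e \<le> u" using len_bounds by blast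
  have "{e \<in> arcs (skel G). vdist G v (tail (skel G) e) \<le> r} \<subseteq>
    {e \<in> arcs (skel G). \<exists>x. 0 < x \<and> x < len G e \<and> path_dist G (Vertex v) (Inner e x) < r + u}"
  proof safe
    fix e assume e: "e \<in> arcs (skel G)" and r: "vdist G v (tail (skel G) e) \<le> r"
    have x: "0 < len G e / 2" "len G e / 2 < len G e" using len_pos[OF e] by auto
    have "path_dist G (Vertex v) (Inner e (len G e / 2)) < r + u"
      using path_dist_tail_le[OF e _ v, of "len G e / 2"] x r u[OF e] by (simp add: edge_pt_def)
    with x show "\<exists>x. 0 < x \<and> x < len G e \<and> path_dist G (Vertex v) (Inner e x) < r + u" by blast
  qed
  then show ?thesis using finite_edges_near[OF v] finite_subset by blast
qed

text \<open>The growth condition counts edges contained in a ball, while the sums below are ordered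
  by the distance of the tail; a tail within \<open>r\<close> puts the whole edge into the ball of
  radius \<open>r + u\<close>.\<close>

lemma card_edges_vdist_le:
  assumes v: "v \<in> verts (skel G)" and u: "\<And>e. e \<in> arcs (skel G) \<Longrightarrow> len G e \<le> u"
  shows "card {e \<in> arcs (skel G). vdist G v (tail (skel G) e) \<le> r} \<le> edges_in_ball G v (r + u)"
  unfolding edges_in_ball_def
proof (rule card_mono)
  let ?B = "{e \<in> arcs (skel G). Inner e ` {0<..<len G e} \<subseteq> mball_of (path_metric G) (Vertex v) (r + u)}"
  have "?B \<subseteq> {e \<in> arcs (skel G). \<exists>x. 0 < x \<and> x < len G e \<and> path_dist G (Vertex v) (Inner e x) < r + u}"
  proof safe
    fix e assume e: "e \<in> arcs (skel G)"
      and s: "Inner e ` {0<..<len G e} \<subseteq> mball_of (path_metric G) (Vertex v) (r + u)"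
    have x: "0 < len G e / 2" "len G e / 2 < len G e" using len_pos[OF e] by auto
    then have "Inner e (len G e / 2) \<in> mball_of (path_metric G) (Vertex v) (r + u)"
      by (intro subsetD[OF s] imageI) simp
    with x show "\<exists>x. 0 < x \<and> x < len G e \<and> path_dist G (Vertex v) (Inner e x) < r + u"
      by (intro exI[of _ "len G e / 2"]) auto
  qed
  then show "finite ?B" using finite_edges_near[OF v] finite_subset by blast
  show "{e \<in> arcs (skel G). vdist G v (tail (skel G) e) \<le> r} \<subseteq> ?B"
  proof safe
    fix e x assume e: "e \<in> arcs (skel G)" and r: "vdist G v (tail (skel G) e) \<le> r"
      and x: "x \<in> {0<..<len G e}"
    then show "Inner e x \<in> mball_of (path_metric G) (Vertex v) (r + u)"
      using path_dist_tail_le[OF e _ v, of x] u[OF e] v by (simp add: edge_pt_def)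
  qed
qed

text \<open>Half of the decay beats the count: eventually the count is at most
  \<open>exp (\<epsilon>/2 * (n + u))\<close>, and a geometric series of ratio
  \<open>exp (- (\<epsilon>/2))\<close> remains.\<close>

lemma summable_edges_exp:
  assumes v: "v \<in> verts (skel G)" and \<epsilon>: "0 < \<epsilon>"
    and growth: "\<And>\<epsilon>. 0 < \<epsilon> \<Longrightarrow> ((\<lambda>r. real (edges_in_ball G v r) * exp (- \<epsilon> * r)) \<longlongrightarrow> 0) at_top"
  shows "summable (\<lambda>n. real (card {e \<in> arcs (skel G). vdist G v (tail (skel G) e) \<le> real n})
    * exp (- \<epsilon> * real n))"
proof -
  obtain u where u: "\<And>e. e \<in> arcs (skel G) \<Longrightarrow> len G e \<le> u" using len_bounds by blast
  let ?E = "\<lambda>n. real (card {e \<in> arcs (skel G). vdist G v (tail (skel G) e) \<le> real n})"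
  have "eventually (\<lambda>r. real (edges_in_ball G v r) * exp (- (\<epsilon>/2) * r) < 1) at_top"
    using order_tendstoD(2)[OF growth[of "\<epsilon>/2"]] \<epsilon> by simp
  moreover have "filterlim (\<lambda>n. real n + u) at_top sequentially"
    using filterlim_tendsto_add_at_top[OF tendsto_const[of u] filterlim_real_sequentially]
    by (simp add: add.commute)
  ultimately have "eventually (\<lambda>n. real (edges_in_ball G v (real n + u)) * exp (- (\<epsilon>/2) * (real n + u)) < 1)
      sequentially" by (rule eventually_compose_filterlim)
  then have "eventually (\<lambda>n. norm (?E n * exp (- \<epsilon> * real n)) \<le> exp (\<epsilon>/2 * u) * exp (- (\<epsilon>/2)) ^ n) sequentially"
  proof eventually_elim
    case (elim n)
    have "?E n * exp (- (\<epsilon>/2) * (real n + u)) \<le> 1"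
      using card_edges_vdist_le[OF v u, of "real n"] elim
      by (meson less_imp_le of_nat_mono mult_right_mono exp_ge_zero order_trans)
    then have "?E n \<le> exp (\<epsilon>/2 * (real n + u))" by (simp add: exp_minus field_simps)
    then have "?E n * exp (- \<epsilon> * real n) \<le> exp (\<epsilon>/2 * (real n + u)) * exp (- \<epsilon> * real n)"
      by (intro mult_right_mono) auto
    also have "\<dots> = exp (\<epsilon>/2 * u + real n * (- (\<epsilon>/2)))"
      by (simp only: exp_add[symmetric]) (simp add: field_simps)
    also have "\<dots> = exp (\<epsilon>/2 * u) * exp (- (\<epsilon>/2)) ^ n"
      by (simp only: exp_add exp_of_nat_mult)
    finally show ?case by simp
  qed
  moreover have "summable (\<lambda>n. exp (\<epsilon>/2 * u) * exp (- (\<epsilon>/2)) ^ n)"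
    using \<epsilon> by (intro summable_mult summable_geometric) simp
  ultimately show ?thesis by (rule summable_comparison_test_ev)
qed

text \<open>The function is dominated by a sum of multiples of indicators of \<open>B n\<close>, the
  union of the edges with tail within \<open>n\<close> of \<open>v\<close>. The coefficients decay
  like \<open>exp (- \<epsilon> n)\<close>, and the measure of \<open>B n\<close> is at most
  \<open>K * u\<close> times the number of its edges.\<close>

lemma nn_integral_exp_decay_finite:
  assumes v: "v \<in> verts (skel G)" and \<epsilon>: "0 < \<epsilon>" and A: "0 \<le> A"
    and growth: "\<And>\<epsilon>. 0 < \<epsilon> \<Longrightarrow> ((\<lambda>r. real (edges_in_ball G v r) * exp (- \<epsilon> * r)) \<longlongrightarrow> 0) at_top"
    and cond: "\<And>e. e \<in> arcs (skel G) \<Longrightarrow> cond G e \<le> K"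
    and Vertex: "\<And>w. w \<in> verts (skel G) \<Longrightarrow> f (Vertex w) \<le> A"
    and Inner: "\<And>e x. e \<in> arcs (skel G) \<Longrightarrow> 0 < x \<Longrightarrow> x < len G e \<Longrightarrow>
      f (Inner e x) \<le> A * exp (- \<epsilon> * vdist G v (tail (skel G) e))"
  shows "(\<integral>\<^sup>+p. ennreal (f p) \<partial>graph_measure G) < \<infinity>"
proof -
  let ?M = "graph_measure G"
  define E where "E n = {e \<in> arcs (skel G). vdist G v (tail (skel G) e) \<le> real n}" for n :: nat
  \<comment> \<open>The vertices belong to every \<open>B n\<close>: being null they do not change
    its measure, and the domination covers them too.\<close>
  define B where "B n = Vertex ` verts (skel G) \<union> {Inner e x |e x. e \<in> E n \<and> 0 < x \<and> x < len G e}" for n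
  obtain u where u: "\<And>e. e \<in> arcs (skel G) \<Longrightarrow> len G e \<le> u" using len_bounds by blast
  obtain e0 where e0: "e0 \<in> arcs (skel G)" using has_edge by blast
  have u0: "0 < u" "0 < K" using u[OF e0] len_pos[OF e0] cond[OF e0] cond_pos[OF e0] by auto
  have finE: "finite (E n)" for n unfolding E_def by (rule finite_edges_vdist_le[OF v])
  have slice: "edge_slice G (B n) e = (if e \<in> E n then {0<..<len G e} else {})"
    if "e \<in> arcs (skel G)" for n e by (auto simp: B_def)
  have B [measurable]: "B n \<in> sets ?M" for n
    using slice by (auto simp: sets_graph_measure B_def points_def E_def)
  have emB: "emeasure ?M (B n) \<le> ennreal (K * u * real (card (E n)))" for n
  proof -
    have "emeasure ?M (B n) = (\<integral>\<^sup>+e. ennreal (cond G e) * emeasure lebesgue (edge_slice G (B n) e)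
        \<partial>count_space (arcs (skel G)))" by (rule emeasure_graph_measure[OF B])
    also have "\<dots> = (\<Sum>e\<in>E n. ennreal (cond G e) * emeasure lebesgue (edge_slice G (B n) e))"
      using slice by (intro nn_integral_count_space' finE) (auto simp: E_def)
    also have "\<dots> \<le> (\<Sum>e\<in>E n. ennreal (K * u))"
    proof (rule sum_mono)
      fix e assume e: "e \<in> E n"
      then have a: "e \<in> arcs (skel G)" by (simp add: E_def)
      have "ennreal (cond G e) * emeasure lebesgue (edge_slice G (B n) e) = ennreal (cond G e * len G e)"
        using slice[OF a] e len_pos[OF a] cond_pos[OF a] by (simp add: ennreal_mult)
      also have "\<dots> \<le> ennreal (K * u)"
        using u[OF a] cond[OF a] len_pos[OF a] u0 by (intro ennreal_leI mult_mono) auto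
      finally show "ennreal (cond G e) * emeasure lebesgue (edge_slice G (B n) e) \<le> ennreal (K * u)" .
    qed
    also have "\<dots> = ennreal (K * u * real (card (E n)))"
      using u0 by (simp add: ennreal_of_nat_eq_real_of_nat ennreal_mult[symmetric] mult_ac)
    finally show ?thesis .
  qed
  \<comment> \<open>The factor \<open>exp \<epsilon>\<close> pays for rounding the distance up to an
    integer.\<close>
  let ?c = "\<lambda>n. A * exp \<epsilon> * exp (- \<epsilon> * real n)"
  have c0: "0 \<le> ?c n" for n using A by simp
  have pt: "ennreal (f p) \<le> (\<Sum>n. ennreal (?c n) * indicator (B n) p)" if p: "p \<in> points G" for p
  proof -
    have "\<exists>n. p \<in> B n \<and> f p \<le> ?c n"
    proof (cases p)
      case (Vertex w)
      then have "f p \<le> A * 1" "A * 1 \<le> A * exp \<epsilon>"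
        using assms(6) p mult_left_mono[of 1 "exp \<epsilon>" A] A \<epsilon> by auto
      then show ?thesis using p Vertex by (intro exI[of _ 0]) (auto simp: B_def)
    next
      case (Inner e x)
      let ?d = "vdist G v (tail (skel G) e)"
      have e: "e \<in> arcs (skel G)" "0 < x" "x < len G e" using p Inner by auto
      define n where "n = nat \<lceil>?d\<rceil>"
      have d: "0 \<le> ?d" by (rule path_dist_nonneg)
      have n: "?d \<le> real n" "real n \<le> ?d + 1" using d unfolding n_def by linarith+
      have "f p \<le> A * exp (- \<epsilon> * ?d)" using assms(7)[OF e] Inner by simp
      also have "\<dots> \<le> A * exp (\<epsilon> + - \<epsilon> * real n)"
      proof (intro mult_left_mono A)
        have "\<epsilon> * real n \<le> \<epsilon> * (?d + 1)" using \<epsilon> n by (intro mult_left_mono) auto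
        then show "exp (- \<epsilon> * ?d) \<le> exp (\<epsilon> + - \<epsilon> * real n)" by (simp add: algebra_simps)
      qed
      also have "\<dots> = ?c n" by (simp only: exp_add mult.assoc)
      finally show ?thesis using n e Inner by (intro exI[of _ n]) (auto simp: B_def E_def)
    qed
    then obtain n where n: "p \<in> B n" "f p \<le> ?c n" by blast
    have "ennreal (f p) \<le> ennreal (?c n) * indicator (B n) p" using n by (simp add: ennreal_leI)
    also have "\<dots> \<le> (\<Sum>n. ennreal (?c n) * indicator (B n) p)"
      using sum_le_suminf[of "\<lambda>n. ennreal (?c n) * indicator (B n) p" "{n}"]
      by (simp del: sum_mult_indicator)
    finally show ?thesis .
  qed
  have "(\<integral>\<^sup>+p. ennreal (f p) \<partial>?M) \<le> (\<integral>\<^sup>+p. (\<Sum>n. ennreal (?c n) * indicator (B n) p) \<partial>?M)"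
    by (intro nn_integral_mono pt) simp
  also have "\<dots> = (\<Sum>n. ennreal (?c n) * emeasure ?M (B n))"
    by (simp add: nn_integral_suminf nn_integral_cmult_indicator)
  also have "\<dots> \<le> (\<Sum>n. ennreal (A * exp \<epsilon> * (K * u) * (real (card (E n)) * exp (- \<epsilon> * real n))))"
  proof (intro suminf_le summableI)
    fix n
    have "ennreal (?c n) * emeasure ?M (B n) \<le> ennreal (?c n) * ennreal (K * u * real (card (E n)))"
      by (intro mult_left_mono emB) simp
    also have "\<dots> = ennreal (A * exp \<epsilon> * (K * u) * (real (card (E n)) * exp (- \<epsilon> * real n)))"
      using c0[of n] u0 by (subst ennreal_mult[symmetric]) (auto simp: mult_ac)
    finally show "ennreal (?c n) * emeasure ?M (B n) \<le> \<dots>" .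
  qed
  also have "\<dots> = ennreal (\<Sum>n. A * exp \<epsilon> * (K * u) * (real (card (E n)) * exp (- \<epsilon> * real n)))"
    using A u0 summable_edges_exp[OF v \<epsilon> growth] unfolding E_def
    by (intro suminf_ennreal2 summable_mult) auto
  also have "\<dots> < \<infinity>" by simp
  finally show ?thesis .
qed

text \<open>Finite unions of closed edges are the compact sets outside which the interpolations will
  be small.\<close>

lemma compactin_edge:
  assumes e: "e \<in> arcs (skel G)"
  shows "compactin (mtopology_of (path_metric G)) (edge_pt G e ` {0..len G e})"
proof (rule image_compactin)
  have "Lipschitz_continuous_map (submetric euclidean_metric {0..len G e}) (path_metric G) (edge_pt G e)"
    unfolding Lipschitz_continuous_map_def
    using edge_pt_in_points[OF e] path_dist_edge_le[OF e] by (auto simp: dist_real_def intro!: exI[of _ 1])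
  then show "continuous_map (subtopology euclidean {0..len G e}) (mtopology_of (path_metric G)) (edge_pt G e)"
    using Lipschitz_continuous_imp_continuous_map by (fastforce simp: mtopology_of_submetric)
  show "compactin (subtopology euclidean {0..len G e}) {0..len G e}"
    by (simp add: compactin_subtopology)
qed

text \<open>Distances are infima of path lengths, so a bound along the closed edges adds up over a
  path with the same constant.\<close>

lemma Lipschitz_on_edges:
  fixes f :: "('v, 'e) gpoint \<Rightarrow> complex"
  assumes lip: "\<And>e x y. e \<in> arcs (skel G) \<Longrightarrow> x \<in> {0..len G e} \<Longrightarrow> y \<in> {0..len G e} \<Longrightarrow>
      cmod (f (edge_pt G e x) - f (edge_pt G e y)) \<le> C * \<bar>x - y\<bar>"
    and C: "0 \<le> C" and pq: "p \<in> points G" "q \<in> points G"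
  shows "cmod (f p - f q) \<le> C * path_dist G p q"
proof -
  have path: "cmod (f p - f q) \<le> C * L" if "gpath G p q L" for q L
    using that
  proof (induction rule: gpath.induct)
    case (step e x L y)
    have "cmod (f p - f (edge_pt G e y)) \<le>
        cmod (f p - f (edge_pt G e x)) + cmod (f (edge_pt G e x) - f (edge_pt G e y))"
      using norm_triangle_ineq[of "f p - f (edge_pt G e x)" "f (edge_pt G e x) - f (edge_pt G e y)"] by simp
    also have "\<dots> \<le> C * L + C * \<bar>x - y\<bar>" by (intro add_mono step.IH lip step.hyps)
    finally show ?case by (simp add: distrib_left)
  qed simp
  show ?thesis
  proof (rule field_le_epsilon)
    fix e :: real assume e: "0 < e"
    \<comment> \<open>Dividing by \<open>C + 1\<close> instead of \<open>C\<close> allows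
      \<open>C = 0\<close>.\<close>
    have "path_dist G p q < path_dist G p q + e / (C + 1)" using e C by simp
    then obtain L where L: "L < path_dist G p q + e / (C + 1)" "gpath G p q L"
      using path_dist_less[OF pq] by blast
    have "cmod (f p - f q) \<le> C * (path_dist G p q + e / (C + 1))"
      using path[OF L(2)] L(1) C by (meson less_imp_le mult_left_mono order_trans)
    also have "\<dots> = C * path_dist G p q + (C / (C + 1)) * e" by (simp add: distrib_left)
    also have "(C / (C + 1)) * e \<le> 1 * e" using C e by (intro mult_right_mono) auto
    finally show "cmod (f p - f q) \<le> C * path_dist G p q + e" by simp
  qed
qed

end

section \<open>Slowly varying interpolations\<close>

lemma ex_antiderivative_poly:
  fixes p :: "'a :: field_char_0 poly"
  shows "\<exists>q. pderiv q = p"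
proof
  have "pderiv (\<Sum>i\<le>degree p. monom (coeff p i / of_nat (Suc i)) (Suc i)) = (\<Sum>i\<le>degree p. monom (coeff p i) i)"
    by (simp add: higher_pderiv_sum[of 1, simplified] pderiv_monom del: of_nat_Suc)
  then show "pderiv (\<Sum>i\<le>degree p. monom (coeff p i / of_nat (Suc i)) (Suc i)) = p"
    by (simp add: poly_as_sum_of_monoms)
qed

text \<open>Each derivative costs at most one factor \<open>a\<close>; by truncated subtraction the
  claim is trivial once \<open>j\<close> reaches \<open>n\<close>.\<close>

lemma power_dvd_higher_pderiv:
  fixes a p :: "'a :: idom poly"
  assumes "a ^ n dvd p" shows "a ^ (n - j) dvd (pderiv ^^ j) p"
proof (induction j)
  case (Suc j)
  then obtain q where q: "(pderiv ^^ j) p = a ^ (n - j) * q" by (elim dvdE)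
  have "a ^ (n - Suc j) dvd pderiv (a ^ (n - j) * q)"
  proof (cases "n - j")
    case (Suc k)
    then have "n - Suc j = k" by simp
    then show ?thesis unfolding Suc pderiv_mult pderiv_power_Suc
      by (intro dvd_add) (auto intro: dvd_mult2 dvd_mult dvd_smult)
  qed simp
  then show ?case using q by simp
qed (use assms in simp)

text \<open>The step is the normalised antiderivative of \<open>x^n (1 - x)^n\<close>, a regularised
  incomplete beta function. It can be normalised because the integrand is positive inside the
  interval.\<close>

lemma ex_flat_step_poly:
  "\<exists>\<eta> :: real poly. poly \<eta> 0 = 0 \<and> poly \<eta> 1 = 1 \<and>
    (\<forall>j. 1 \<le> j \<and> j \<le> n \<longrightarrow> poly ((pderiv ^^ j) \<eta>) 0 = 0 \<and> poly ((pderiv ^^ j) \<eta>) 1 = 0)"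
proof -
  define r :: "real poly" where "r = [:0, 1:] ^ n * [:1, -1:] ^ n"
  obtain q where q: "pderiv q = r" using ex_antiderivative_poly by blast
  have "poly q 0 < poly q 1"
  proof (rule DERIV_pos_imp_increasing_open[of 0 1 "poly q"])
    fix x :: real assume "0 < x" "x < 1"
    then have "0 < poly r x" by (simp add: r_def)
    then show "\<exists>y. DERIV (poly q) x :> y \<and> 0 < y" using poly_DERIV[of q x] q by auto
  qed (auto intro: continuous_intros)
  define c where "c = 1 / (poly q 1 - poly q 0)"
  define \<eta> where "\<eta> = smult c (q - [:poly q 0:])"
  have "pderiv \<eta> = smult c r" by (simp add: \<eta>_def pderiv_smult pderiv_diff pderiv_pCons q)
  have flat: "poly ((pderiv ^^ j) \<eta>) z = 0"
    if j: "1 \<le> j" "j \<le> n" and a: "poly a z = 0" "a ^ n dvd r" for j z and a :: "real poly"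
  proof -
    \<comment> \<open>The j-th derivative of \<open>\<eta>\<close> is the derivative of order
      \<open>j - 1\<close> of the integrand, so a factor vanishing at the end point survives up to
      and including \<open>j = n\<close>.\<close>
    obtain i where i: "j = Suc i" using j by (cases j) auto
    have "a ^ (n - i) dvd (pderiv ^^ i) (smult c r)"
      using a by (intro power_dvd_higher_pderiv dvd_smult)
    moreover have "a dvd a ^ (n - i)" using i j by (intro dvd_power) auto
    ultimately have "a dvd (pderiv ^^ i) (smult c r)" by (rule dvd_trans[rotated])
    moreover have "(pderiv ^^ i) (smult c r) = (pderiv ^^ j) \<eta>"
      unfolding i funpow_Suc_right o_def by (simp only: \<open>pderiv \<eta> = smult c r\<close>)
    ultimately show ?thesis using a(1) by (auto elim!: dvdE)
  qed
  have "poly \<eta> 0 = 0" "poly \<eta> 1 = 1" using \<open>poly q 0 < poly q 1\<close> by (auto simp: \<eta>_def c_def)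
  moreover have "poly ((pderiv ^^ j) \<eta>) 0 = 0" "poly ((pderiv ^^ j) \<eta>) 1 = 0" if "1 \<le> j" "j \<le> n" for j
    using flat[OF that, of "[:0, 1:]" 0] flat[OF that, of "[:1, -1:]" 1] by (auto simp: r_def)
  ultimately show ?thesis by blast
qed

text \<open>A classical second derivative is a weak one:
  \<open>deriv \<phi> * u - \<phi> * w\<close> is an antiderivative of the difference of the two
  integrands, which amounts to both integrations by parts at once.\<close>

lemma second_deriv_Lp:
  fixes u w g :: "real \<Rightarrow> complex"
  assumes u: "\<And>x. (u has_vector_derivative w x) (at x)"
    and w: "\<And>x. (w has_vector_derivative g x) (at x)"
    and g: "continuous_on UNIV g"
  shows "second_deriv (Lp p) l u g"
  unfolding second_deriv.simps
proof
  fix \<phi> assume "\<phi> \<in> test_functions l"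
  then obtain a b where ab: "0 < a" "b < l" "\<And>x. x \<notin> {a..b} \<Longrightarrow> \<phi> x = 0"
    and smooth: "\<And>k x. (deriv ^^ k) \<phi> differentiable (at x)" unfolding test_functions_def by blast
  have d0: "(\<phi> has_vector_derivative deriv \<phi> x) (at x)" for x
    using smooth[of 0 x] by (simp add: DERIV_deriv_iff_real_differentiable has_real_derivative_iff_has_vector_derivative[symmetric])
  have d1: "(deriv \<phi> has_vector_derivative (deriv ^^ 2) \<phi> x) (at x)" for x
    using smooth[of 1 x] by (simp add: DERIV_deriv_iff_real_differentiable has_real_derivative_iff_has_vector_derivative[symmetric] numeral_2_eq_2)
  have c: "continuous_on S u" "continuous_on S g" "continuous_on S \<phi>" "continuous_on S ((deriv ^^ 2) \<phi>)" for S
  proof -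
    show "continuous_on S u"
      using u has_vector_derivative_continuous by (blast intro: continuous_at_imp_continuous_on)
    show "continuous_on S g" using g continuous_on_subset by blast
    show "continuous_on S \<phi>" "continuous_on S ((deriv ^^ 2) \<phi>)"
      using smooth[of 0] smooth[of 2]
      by (auto intro!: continuous_at_imp_continuous_on differentiable_imp_continuous_within)
  qed
  \<comment> \<open>The complement of \<open>{a..b}\<close> is open, so the derivative vanishes
    there as well; hence the boundary terms at 0 and \<open>l\<close> are zero.\<close>
  have z: "\<phi> x = 0 \<and> deriv \<phi> x = 0" if x: "x \<notin> {a..b}" for x
  proof -
    have "eventually (\<lambda>y. y \<in> - {a..b}) (nhds x)" using x by (intro eventually_nhds_in_open) auto
    then have "eventually (\<lambda>y. \<phi> y = 0) (nhds x)" by eventually_elim (use ab in auto)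
    then have "deriv \<phi> x = deriv (\<lambda>_. 0) x" by (intro deriv_cong_ev) auto
    then show ?thesis using ab x by simp
  qed
  show "(LINT x:{0<..<l}|lebesgue. (deriv ^^ 2) \<phi> x *\<^sub>R u x) = (LINT x:{0<..<l}|lebesgue. \<phi> x *\<^sub>R g x)"
  proof (cases "0 \<le> l")
    case True
    have "((\<lambda>x. (deriv ^^ 2) \<phi> x *\<^sub>R u x - \<phi> x *\<^sub>R g x) has_integral
        (deriv \<phi> l *\<^sub>R u l - \<phi> l *\<^sub>R w l) - (deriv \<phi> 0 *\<^sub>R u 0 - \<phi> 0 *\<^sub>R w 0)) {0..l}"
    proof (rule fundamental_theorem_of_calculus[OF True])
      fix x
      have "((\<lambda>x. deriv \<phi> x *\<^sub>R u x - \<phi> x *\<^sub>R w x) has_vector_derivative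
          (deriv \<phi> x *\<^sub>R w x + (deriv ^^ 2) \<phi> x *\<^sub>R u x) - (\<phi> x *\<^sub>R g x + deriv \<phi> x *\<^sub>R w x)) (at x)"
        using u w d0 d1 by (intro has_vector_derivative_diff has_vector_derivative_scaleR)
          (simp_all only: has_real_derivative_iff_has_vector_derivative)
      moreover have "(deriv \<phi> x *\<^sub>R w x + (deriv ^^ 2) \<phi> x *\<^sub>R u x) - (\<phi> x *\<^sub>R g x + deriv \<phi> x *\<^sub>R w x)
          = (deriv ^^ 2) \<phi> x *\<^sub>R u x - \<phi> x *\<^sub>R g x" by (subst (2) add.commute) (rule add_diff_cancel_left)
      ultimately show "((\<lambda>x. deriv \<phi> x *\<^sub>R u x - \<phi> x *\<^sub>R w x) has_vector_derivative
          (deriv ^^ 2) \<phi> x *\<^sub>R u x - \<phi> x *\<^sub>R g x) (at x within {0..l})"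
        by (metis has_vector_derivative_at_within)
    qed
    then have "integral {0..l} (\<lambda>x. (deriv ^^ 2) \<phi> x *\<^sub>R u x - \<phi> x *\<^sub>R g x) = 0"
      using z[of 0] z[of l] ab by (simp add: integral_unique)
    moreover have i: "(\<lambda>x. (deriv ^^ 2) \<phi> x *\<^sub>R u x) integrable_on {0..l}"
        "(\<lambda>x. \<phi> x *\<^sub>R g x) integrable_on {0..l}"
      by (intro integrable_continuous_interval continuous_on_scaleR c)+
    ultimately have "integral {0..l} (\<lambda>x. (deriv ^^ 2) \<phi> x *\<^sub>R u x) = integral {0..l} (\<lambda>x. \<phi> x *\<^sub>R g x)"
      unfolding integral_diff[OF i] by (simp only: right_minus_eq)
    moreover have "(LINT x:{0<..<l}|lebesgue. h x) = integral {0..l} h" if h: "continuous_on {0..l} h"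
      for h :: "real \<Rightarrow> complex"
    proof -
      have "set_integrable lebesgue {0..l} h" using absolutely_integrable_continuous_real[OF h] .
      then have "set_integrable lebesgue {0<..<l} h" by (rule set_integrable_subset) auto
      then show ?thesis by (simp add: set_lebesgue_integral_eq_integral(2) integral_open_interval_real)
    qed
    ultimately show ?thesis by (simp add: continuous_on_scaleR c)
  next
    case False
    then show ?thesis by (simp add: set_lebesgue_integral_def)
  qed
qed

text \<open>
  \<open>profile G \<eta> \<psi> e j\<close> is the \<open>j\<close>-th derivative on the edge \<open>e\<close> of the interpolation of the vertex
  function \<open>\<psi>\<close> along the step polynomial \<open>\<eta>\<close>, and \<open>interp G \<eta> \<psi> k\<close> is \<open>(-\<Delta>)\<^sup>k\<close> of this interpolation. At the
  vertices, the derivatives vanish if \<open>\<eta>\<close> is flat at \<open>0\<close> and \<open>1\<close>.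
\<close>

definition profile :: "('v, 'e) mgraph \<Rightarrow> real poly \<Rightarrow> ('v \<Rightarrow> real) \<Rightarrow> 'e \<Rightarrow> nat \<Rightarrow> real \<Rightarrow> real" where
  "profile G \<eta> \<psi> e j x = (if j = 0 then \<psi> (tail (skel G) e) else 0) +
    (\<psi> (head (skel G) e) - \<psi> (tail (skel G) e)) * (poly ((pderiv ^^ j) \<eta>) (x / len G e) / len G e ^ j)"

definition interp :: "('v, 'e) mgraph \<Rightarrow> real poly \<Rightarrow> ('v \<Rightarrow> real) \<Rightarrow> nat \<Rightarrow> ('v, 'e) gpoint \<Rightarrow> complex" where
  "interp G \<eta> \<psi> k p = (case p of
      Vertex w \<Rightarrow> if k = 0 then of_real (\<psi> w) else 0
    | Inner e x \<Rightarrow> of_real ((-1) ^ k * profile G \<eta> \<psi> e (2 * k) x))"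

lemma interp_Inner: "interp G \<eta> \<psi> k (Inner e x) = of_real ((-1) ^ k * profile G \<eta> \<psi> e (2 * k) x)"
  by (simp add: interp_def)

context metric_graph
begin

lemma profile_has_derivative:
  assumes e: "e \<in> arcs (skel G)"
  shows "(profile G \<eta> \<psi> e j has_real_derivative profile G \<eta> \<psi> e (Suc j) x) (at x)"
proof -
  have l: "len G e \<noteq> 0" using len_pos[OF e] by simp
  have "((\<lambda>x. poly ((pderiv ^^ j) \<eta>) (x / len G e)) has_real_derivative
      poly (pderiv ((pderiv ^^ j) \<eta>)) (x / len G e) * (1 / len G e)) (at x)"
    using l by (intro DERIV_chain2[OF poly_DERIV]) (auto intro!: derivative_eq_intros)
  then have "((\<lambda>x. (if j = 0 then \<psi> (tail (skel G) e) else 0) + (\<psi> (head (skel G) e) - \<psi> (tail (skel G) e)) *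
      (poly ((pderiv ^^ j) \<eta>) (x / len G e) / len G e ^ j)) has_real_derivative
      0 + (\<psi> (head (skel G) e) - \<psi> (tail (skel G) e)) *
        (poly (pderiv ((pderiv ^^ j) \<eta>)) (x / len G e) * (1 / len G e) / len G e ^ j)) (at x)"
    by (intro DERIV_add DERIV_const DERIV_cmult DERIV_cdivide)
  then show ?thesis by (simp add: profile_def[abs_def] mult.commute)
qed

lemma continuous_on_profile: "e \<in> arcs (skel G) \<Longrightarrow> continuous_on S (profile G \<eta> \<psi> e j)"
  using profile_has_derivative DERIV_isCont by (blast intro: continuous_at_imp_continuous_on)

lemma interp_vector_derivative:
  assumes e: "e \<in> arcs (skel G)"
  shows "((\<lambda>s. of_real ((-1) ^ k * profile G \<eta> \<psi> e j s) :: complex) has_vector_derivative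
    of_real ((-1) ^ k * profile G \<eta> \<psi> e (Suc j) x)) (at x)"
  using DERIV_cmult[OF profile_has_derivative[OF e, of \<eta> \<psi> j x], of "(-1)^k"]
  by (intro has_vector_derivative_of_real) (simp add: has_real_derivative_iff_has_vector_derivative)

lemma second_deriv_interp:
  assumes e: "e \<in> arcs (skel G)"
  shows "second_deriv X (len G e) (\<lambda>s. interp G \<eta> \<psi> k (Inner e s)) (\<lambda>s. - interp G \<eta> \<psi> (Suc k) (Inner e s))"
proof -
  let ?w = "\<lambda>s. of_real ((-1) ^ k * profile G \<eta> \<psi> e (Suc (2 * k)) s) :: complex"
  have g: "- interp G \<eta> \<psi> (Suc k) (Inner e s) = of_real ((-1) ^ k * profile G \<eta> \<psi> e (Suc (Suc (2 * k))) s)" for s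
    by (simp add: interp_Inner)
  note d = interp_vector_derivative[OF e, of k \<eta> \<psi>]
  show ?thesis
  proof (cases X)
    case (Lp p)
    show ?thesis unfolding Lp g unfolding interp_Inner
      by (rule second_deriv_Lp[of _ ?w, OF d d])
        (intro continuous_intros continuous_on_profile e)
  next
    case C0
    show ?thesis unfolding C0 g unfolding interp_Inner second_deriv.simps using d by (intro exI[of _ ?w]) blast
  next
    case BUC
    show ?thesis unfolding BUC g unfolding interp_Inner second_deriv.simps using d by (intro exI[of _ ?w]) blast
  qed
qed

text \<open>No vertex is isolated: a path to it from an end of some fixed edge is trivial or has a
  last segment, which lies on an edge.\<close>

lemma points_edge_pt: "p \<in> points G \<Longrightarrow> \<exists>e x. e \<in> arcs (skel G) \<and> x \<in> {0..len G e} \<and> p = edge_pt G e x"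
proof -
  assume p: "p \<in> points G"
  obtain e where e: "e \<in> arcs (skel G)" using has_edge by blast
  have q: "edge_pt G e 0 \<in> points G" using edge_pt_in_points[OF e, of 0] len_pos[OF e] by simp
  obtain L where "gpath G (edge_pt G e 0) p L" using gpath_exists[OF q p] by blast
  then show ?thesis
  proof cases
    case refl
    then show ?thesis using e len_pos[OF e] by (intro exI[of _ e] exI[of _ 0]) auto
  next
    case (step f x M y)
    then show ?thesis by blast
  qed
qed

text \<open>Compactness of \<open>{0..1}\<close> bounds the derivatives of the polynomial and the
  minimal length bounds the scaling factors. Summing over the orders gives one constant for all of
  them, and the summand 1 makes it positive.\<close>

lemma ex_profile_bound:
  "\<exists>C>0. \<forall>e\<in>arcs (skel G). \<forall>j\<le>n. \<forall>x\<in>{0..len G e}. \<bar>poly ((pderiv ^^ j) \<eta>) (x / len G e) / len G e ^ j\<bar> \<le> C"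
proof -
  obtain l where l: "0 < l" "\<And>e. e \<in> arcs (skel G) \<Longrightarrow> l \<le> len G e" using len_bounds by blast
  have "\<exists>B. \<forall>y\<in>{0..1}. \<bar>poly ((pderiv ^^ j) \<eta>) y\<bar> \<le> B" for j
    using compact_imp_bounded[OF compact_continuous_image[OF _ compact_Icc], of 0 1 "poly ((pderiv ^^ j) \<eta>)"]
    by (force simp: bounded_iff intro: continuous_intros)
  then obtain B where B: "\<And>j y. y \<in> {0..1} \<Longrightarrow> \<bar>poly ((pderiv ^^ j) \<eta>) y\<bar> \<le> B j" by metis
  define C where "C = 1 + (\<Sum>j\<le>n. B j / l ^ j)"
  have B0: "0 \<le> B j" for j using B[of 0 j] by force
  have "\<bar>poly ((pderiv ^^ j) \<eta>) (x / len G e) / len G e ^ j\<bar> \<le> C"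
    if e: "e \<in> arcs (skel G)" and j: "j \<le> n" and x: "x \<in> {0..len G e}" for e j x
  proof -
    have "x / len G e \<in> {0..1}" using x len_pos[OF e] by (auto simp: field_simps)
    then have "\<bar>poly ((pderiv ^^ j) \<eta>) (x / len G e)\<bar> / len G e ^ j \<le> B j / l ^ j"
      using l e B0 by (intro frac_le B zero_less_power power_mono) auto
    also have "\<dots> \<le> (\<Sum>j\<le>n. B j / l ^ j)"
      using B0 l j by (intro member_le_sum[of j "{..n}" "\<lambda>j. B j / l ^ j"]) auto
    finally show ?thesis using len_pos[OF e] by (simp add: C_def)
  qed
  moreover have "0 < C" unfolding C_def using B0 l by (intro add_pos_nonneg sum_nonneg) auto
  ultimately show ?thesis by blast
qed

end

text \<open>\<open>\<kappa>\<close> measures the variation of \<open>\<psi>\<close> across an edge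
  relative to its size, and \<open>C\<close> the derivatives of the step rescaled to an edge. The
  condition \<open>C * \<kappa> \<le> 1/2\<close> keeps the interpolation between half and twice the
  value at the tail.\<close>

locale slow_interpolation = metric_graph G for G :: "('v, 'e) mgraph" +
  fixes \<eta> :: "real poly" and \<psi> :: "'v \<Rightarrow> real" and m :: nat and C \<kappa> :: real
  assumes \<eta>0: "poly \<eta> 0 = 0" and \<eta>1: "poly \<eta> 1 = 1"
    and flat: "1 \<le> j \<Longrightarrow> j \<le> Suc (2 * m) \<Longrightarrow> poly ((pderiv ^^ j) \<eta>) 0 = 0 \<and> poly ((pderiv ^^ j) \<eta>) 1 = 0"
    and C: "e \<in> arcs (skel G) \<Longrightarrow> j \<le> Suc (2 * m) \<Longrightarrow> x \<in> {0..len G e} \<Longrightarrow>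
      \<bar>poly ((pderiv ^^ j) \<eta>) (x / len G e) / len G e ^ j\<bar> \<le> C"
    and C_pos: "0 < C"
    and \<psi>_pos: "w \<in> verts (skel G) \<Longrightarrow> 0 < \<psi> w" and \<psi>_le: "w \<in> verts (skel G) \<Longrightarrow> \<psi> w \<le> 1"
    and slow: "e \<in> arcs (skel G) \<Longrightarrow> \<bar>\<psi> (head (skel G) e) - \<psi> (tail (skel G) e)\<bar> \<le> \<kappa> * \<psi> (tail (skel G) e)"
    and \<kappa>: "C * \<kappa> \<le> 1/2"
begin

abbreviation "F \<equiv> interp G \<eta> \<psi>"

text \<open>The formula from the inside of an edge extends to its ends: by the values 0 and 1 of
  \<open>\<eta>\<close> for \<open>k = 0\<close>, by flatness for larger \<open>k\<close>. This is
  what makes \<open>F k\<close> continuous at the vertices.\<close>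

lemma interp_edge_pt:
  assumes e: "e \<in> arcs (skel G)" and x: "x \<in> {0..len G e}" and k: "k \<le> m"
  shows "F k (edge_pt G e x) = of_real ((-1) ^ k * profile G \<eta> \<psi> e (2 * k) x)"
  using len_pos[OF e] flat[of "2 * k"] k \<eta>0 \<eta>1
  by (auto simp: edge_pt_def interp_def profile_def)

lemma profile_bound:
  assumes e: "e \<in> arcs (skel G)" and x: "x \<in> {0..len G e}" and j: "j \<le> Suc (2 * m)"
  shows "\<bar>profile G \<eta> \<psi> e j x - (if j = 0 then \<psi> (tail (skel G) e) else 0)\<bar> \<le> C * \<kappa> * \<psi> (tail (skel G) e)"
proof -
  have "\<bar>(\<psi> (head (skel G) e) - \<psi> (tail (skel G) e)) * (poly ((pderiv ^^ j) \<eta>) (x / len G e) / len G e ^ j)\<bar>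
      \<le> (\<kappa> * \<psi> (tail (skel G) e)) * C"
    unfolding abs_mult using slow[OF e] C[OF e j x] by (intro mult_mono) auto
  then show ?thesis by (simp add: profile_def mult_ac)
qed

lemma interp_0_bounds:
  assumes e: "e \<in> arcs (skel G)" and x: "x \<in> {0..len G e}"
  shows "\<psi> (tail (skel G) e) / 2 \<le> cmod (F 0 (edge_pt G e x))"
    and "cmod (F 0 (edge_pt G e x)) \<le> 2 * \<psi> (tail (skel G) e)"
proof -
  have p: "0 < \<psi> (tail (skel G) e)" using \<psi>_pos e by simp
  have "C * \<kappa> * \<psi> (tail (skel G) e) \<le> 1/2 * \<psi> (tail (skel G) e)"
    using \<kappa> p by (intro mult_right_mono) auto
  then have "\<bar>profile G \<eta> \<psi> e 0 x - \<psi> (tail (skel G) e)\<bar> \<le> \<psi> (tail (skel G) e) / 2"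
    using profile_bound[OF e x, of 0] by simp
  then have "\<psi> (tail (skel G) e) / 2 \<le> \<bar>profile G \<eta> \<psi> e 0 x\<bar>"
    "\<bar>profile G \<eta> \<psi> e 0 x\<bar> \<le> 2 * \<psi> (tail (skel G) e)"
    using p by linarith+
  then show "\<psi> (tail (skel G) e) / 2 \<le> cmod (F 0 (edge_pt G e x))"
    "cmod (F 0 (edge_pt G e x)) \<le> 2 * \<psi> (tail (skel G) e)"
    using interp_edge_pt[OF e x, of 0] by simp_all
qed

lemma \<kappa>_nonneg: "0 \<le> \<kappa>"
proof -
  obtain e where e: "e \<in> arcs (skel G)" using has_edge by blast
  have "0 \<le> \<kappa> * \<psi> (tail (skel G) e)" using slow[OF e] by linarith
  then show ?thesis using \<psi>_pos[of "tail (skel G) e"] e by (simp add: zero_le_mult_iff)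
qed

text \<open>Both sides are compared with \<open>\<psi>\<close> at the tail: \<open>F k\<close> is at
  most \<open>C * \<kappa>\<close> times it and \<open>F 0\<close> at least half of it, whence the
  factor 2.\<close>

lemma interp_bound:
  assumes p: "p \<in> points G" and k: "1 \<le> k" "k \<le> m"
  shows "cmod (F k p) \<le> 2 * C * \<kappa> * cmod (F 0 p)"
proof -
  obtain e x where ex: "e \<in> arcs (skel G)" "x \<in> {0..len G e}" "p = edge_pt G e x"
    using points_edge_pt[OF p] by blast
  have "cmod (F k p) \<le> C * \<kappa> * \<psi> (tail (skel G) e)"
    using profile_bound[OF ex(1,2), of "2 * k"] k interp_edge_pt[OF ex(1,2) k(2)] ex(3) by (simp add: norm_mult norm_power)
  also have "\<dots> \<le> C * \<kappa> * (2 * cmod (F 0 p))"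
    using interp_0_bounds(1)[OF ex(1,2)] ex(3) \<kappa>_nonneg C_pos by (intro mult_left_mono) auto
  finally show ?thesis by (simp add: mult_ac)
qed

text \<open>Reduces the boundedness, decay and integrability of every \<open>F k\<close> to
  estimates of \<open>F 0\<close>.\<close>

lemma interp_le_interp_0:
  assumes p: "p \<in> points G" and k: "k \<le> m"
  shows "cmod (F k p) \<le> cmod (F 0 p)"
proof (cases "k = 0")
  case False
  have "2 * C * \<kappa> * cmod (F 0 p) \<le> 1 * cmod (F 0 p)" using \<kappa> by (intro mult_right_mono) auto
  then show ?thesis using interp_bound[OF p _ k] False by linarith
qed simp

lemma interp_0_nonzero:
  assumes "p \<in> points G" shows "F 0 p \<noteq> 0"
proof -
  obtain e x where "e \<in> arcs (skel G)" "x \<in> {0..len G e}" "p = edge_pt G e x"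
    using points_edge_pt[OF assms] by blast
  then show ?thesis using interp_0_bounds(1)[of e x] \<psi>_pos[of "tail (skel G) e"] by auto
qed

text \<open>The derivative of \<open>F k\<close> along an edge has order \<open>2 * k + 1\<close>,
  which is why \<open>C\<close> has to cover the order \<open>2 * m + 1\<close>;
  \<open>\<psi> \<le> 1\<close> makes the constant the same on all edges.\<close>

lemma interp_Lipschitz:
  assumes k: "k \<le> m" and pq: "p \<in> points G" "q \<in> points G"
  shows "cmod (F k p - F k q) \<le> C * \<kappa> * path_dist G p q"
proof (rule Lipschitz_on_edges[OF _ _ pq])
  show "0 \<le> C * \<kappa>" using C_pos \<kappa>_nonneg by simp
  fix e x y assume e: "e \<in> arcs (skel G)" and xy: "x \<in> {0..len G e}" "y \<in> {0..len G e}"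
  have "cmod (F k (edge_pt G e x) - F k (edge_pt G e y)) =
      \<bar>profile G \<eta> \<psi> e (2 * k) x - profile G \<eta> \<psi> e (2 * k) y\<bar>"
    unfolding interp_edge_pt[OF e xy(1) k] interp_edge_pt[OF e xy(2) k] of_real_diff[symmetric]
      norm_of_real right_diff_distrib[symmetric] by (simp add: abs_mult)
  also have "\<dots> = norm (profile G \<eta> \<psi> e (2 * k) x - profile G \<eta> \<psi> e (2 * k) y)" by simp
  also have "\<dots> \<le> C * \<kappa> * norm (x - y)"
  proof (rule field_differentiable_bound[of "{0..len G e}"])
    fix z assume z: "z \<in> {0..len G e}"
    show "(profile G \<eta> \<psi> e (2 * k) has_real_derivative profile G \<eta> \<psi> e (Suc (2 * k)) z) (at z within {0..len G e})"
      using profile_has_derivative[OF e] has_field_derivative_at_within by blast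
    have "\<bar>profile G \<eta> \<psi> e (Suc (2 * k)) z\<bar> \<le> C * \<kappa> * \<psi> (tail (skel G) e)"
      using profile_bound[OF e z, of "Suc (2 * k)"] k by simp
    also have "\<dots> \<le> C * \<kappa> * 1"
      using \<psi>_le[of "tail (skel G) e"] e C_pos \<kappa>_nonneg by (intro mult_left_mono) auto
    finally show "norm (profile G \<eta> \<psi> e (Suc (2 * k)) z) \<le> C * \<kappa>" by simp
  qed (use xy in auto)
  finally show "cmod (F k (edge_pt G e x) - F k (edge_pt G e y)) \<le> C * \<kappa> * \<bar>x - y\<bar>" by simp
qed

lemma uniformly_continuous_interp:
  assumes k: "k \<le> m" shows "uniformly_continuous_map (path_metric G) euclidean_metric (F k)"
proof (rule Lipschitz_imp_uniformly_continuous_map)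
  show "Lipschitz_continuous_map (path_metric G) euclidean_metric (F k)"
    unfolding Lipschitz_continuous_map_def using interp_Lipschitz[OF k] by (auto simp: dist_norm)
qed

lemma continuous_interp: "k \<le> m \<Longrightarrow> continuous_map (mtopology_of (path_metric G)) euclidean (F k)"
  using uniformly_continuous_imp_continuous_map[OF uniformly_continuous_interp] by simp

text \<open>Each normal derivative vanishes by itself, being a derivative of odd order at a flat
  end, so neither conductivities nor degrees of vertices matter.\<close>

lemma kirchhoff_interp:
  assumes k: "k \<le> m" shows "kirchhoff G (F k)"
proof -
  have "normal_deriv G (F k) e w = 0" if e: "e \<in> arcs (skel G)" for e w
  proof -
    let ?w = "\<lambda>s. of_real ((-1) ^ k * profile G \<eta> \<psi> e (Suc (2 * k)) s) :: complex"
    have d: "vector_derivative (\<lambda>s. F k (Inner e s)) (at x) = ?w x" for x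
      unfolding interp_Inner by (rule vector_derivative_at[OF interp_vector_derivative[OF e]])
    have cont: "isCont ?w x" for x
      using continuous_on_profile[OF e, of UNIV] by (intro continuous_intros) (auto simp: continuous_on_eq_continuous_at)
    have z: "?w 0 = 0" "?w (len G e) = 0"
      using flat[of "Suc (2 * k)"] k len_pos[OF e] by (auto simp: profile_def)
    have "(?w \<longlongrightarrow> 0) (at 0)" "(?w \<longlongrightarrow> 0) (at (len G e))"
      using cont[of 0] cont[of "len G e"] unfolding isCont_def z by blast+
    then have "(?w \<longlongrightarrow> 0) (at_right 0)" "(?w \<longlongrightarrow> 0) (at_left (len G e))"
      by (blast intro: tendsto_within_subset)+
    then have "Lim (at_right 0) ?w = 0" "Lim (at_left (len G e)) ?w = 0"
      by (simp_all only: tendsto_Lim trivial_limit_at_right_real trivial_limit_at_left_real not_False_eq_True)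
    then show ?thesis unfolding normal_deriv_def d Let_def by simp
  qed
  then show ?thesis unfolding kirchhoff_def by (auto simp: incident_def intro!: sum.neutral)
qed

text \<open>\<open>F k\<close> is its own continuous representative. The minus sign appears because
  \<open>F\<close> enumerates the powers of the negative Laplacian.\<close>

lemma interp_in_laplacian:
  assumes k: "Suc k \<le> m" and carr: "F k \<in> carr G X" "(\<lambda>x. - F (Suc k) x) \<in> carr G X"
  shows "(F k, \<lambda>x. - F (Suc k) x) \<in> laplacian G X"
proof -
  obtain q where "q \<in> points G" using points_nonempty by blast
  then have "snorm G X (\<lambda>x. F k x - F k x) = 0"
    using points_nonempty by (cases X) auto
  then show ?thesis
    using carr continuous_interp[of k] kirchhoff_interp[of k] second_deriv_interp k
    unfolding laplacian_def by (auto intro!: bexI[of _ "F k"])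
qed

lemma interp_in_poly_laplacian:
  assumes carr: "\<And>k. k \<le> m \<Longrightarrow> F k \<in> carr G X" "\<And>k. k \<le> m \<Longrightarrow> (\<lambda>x. - F k x) \<in> carr G X"
  shows "(F 0, \<lambda>x. - F m x) \<in> poly_laplacian G X m"
proof -
  have "(F 0, F k) \<in> neg_op (laplacian G X) ^^ k" if "k \<le> m" for k
    using that
  proof (induction k)
    case (Suc k)
    have "(F k, \<lambda>x. - F (Suc k) x) \<in> laplacian G X"
      using Suc.prems by (intro interp_in_laplacian carr) auto
    then have "(F k, F (Suc k)) \<in> neg_op (laplacian G X)" by (force simp: neg_op_def)
    then show ?case using Suc by auto
  qed simp
  then show ?thesis unfolding poly_laplacian_def neg_op_def by blast
qed

end

section \<open>Comparison of norms and membership of the interpolations in the spaces\<close>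

context metric_graph
begin

lemma complete_seminorm_carr:
  assumes "X \<in> {Lp p |p. 1 \<le> p} \<union> {C0, BUC}"
  shows "complete_seminorm (carr G X) (snorm G X)"
  using assms complete_seminorm_Lp complete_seminorm_C0 complete_seminorm_BUC by blast

lemma bdd_above_carr:
  assumes "f \<in> carr G X" "X \<in> {C0, BUC}" shows "bdd_above ((\<lambda>x. cmod (f x)) ` points G)"
proof -
  have "bounded (f ` points G)" using assms carr_C0_bounded by auto
  then show ?thesis by (auto simp: bounded_iff bdd_above_def)
qed

lemma snorm_le:
  assumes X: "X \<in> {Lp p |p. 1 \<le> p} \<union> {C0, BUC}"
    and f: "f \<in> carr G X" and g: "g \<in> carr G X" and c: "0 \<le> c"
    and le: "\<And>x. x \<in> points G \<Longrightarrow> cmod (f x) \<le> c * cmod (g x)"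
  shows "snorm G X f \<le> c * snorm G X g"
proof -
  consider p where "X = Lp p" "1 \<le> p" | "X \<in> {C0, BUC}" using X by auto
  then show ?thesis
  proof cases
    case 1
    let ?M = "graph_measure G"
    have int: "integrable ?M (\<lambda>x. cmod (f x) powr p)" "integrable ?M (\<lambda>x. cmod (g x) powr p)"
      using f g 1 by auto
    have "(\<integral>x. cmod (f x) powr p \<partial>?M) \<le> (\<integral>x. c powr p * cmod (g x) powr p \<partial>?M)"
    proof (intro integral_mono int integrable_mult_right)
      fix x assume "x \<in> space ?M"
      then show "cmod (f x) powr p \<le> c powr p * cmod (g x) powr p"
        using le[of x] 1 powr_mono2[of p "cmod (f x)" "c * cmod (g x)"] by (simp add: powr_mult)
    qed
    also have "\<dots> = c powr p * (\<integral>x. cmod (g x) powr p \<partial>?M)" by simp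
    finally have "(\<integral>x. cmod (f x) powr p \<partial>?M) powr (1/p)
        \<le> (c powr p * (\<integral>x. cmod (g x) powr p \<partial>?M)) powr (1/p)"
      using 1 by (intro powr_mono2 integral_nonneg_AE) auto
    also have "\<dots> = c * (\<integral>x. cmod (g x) powr p \<partial>?M) powr (1/p)"
      using 1 c by (simp add: powr_mult powr_powr)
    finally show ?thesis using 1 by simp
  next
    case 2
    have "(SUP x\<in>points G. cmod (f x)) \<le> c * (SUP x\<in>points G. cmod (g x))"
    proof (rule cSUP_least[OF points_nonempty])
      fix x assume x: "x \<in> points G"
      have "cmod (g x) \<le> (SUP x\<in>points G. cmod (g x))"
        by (rule cSUP_upper[OF x bdd_above_carr[OF g 2]])
      then show "cmod (f x) \<le> c * (SUP x\<in>points G. cmod (g x))"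
        using le[OF x] c by (meson mult_left_mono order_trans)
    qed
    then show ?thesis using 2 by auto
  qed
qed

lemma emeasure_points_pos: "emeasure (graph_measure G) (points G) \<noteq> 0"
proof -
  obtain e where e: "e \<in> arcs (skel G)" using has_edge by blast
  have slice: "edge_slice G (points G) e = {0<..<len G e}" using e by auto
  have "points G \<in> sets (graph_measure G)" using sets.top[of "graph_measure G"] by simp
  then have em: "emeasure (graph_measure G) (points G) = (\<integral>\<^sup>+ e. ennreal (cond G e) *
      emeasure lebesgue (edge_slice G (points G) e) \<partial>count_space (arcs (skel G)))"
    by (rule emeasure_graph_measure)
  have "0 < ennreal (cond G e) * emeasure lebesgue (edge_slice G (points G) e)"
    unfolding slice using cond_pos[OF e] len_pos[OF e] by (simp add: ennreal_zero_less_mult_iff)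
  also have "\<dots> \<le> emeasure (graph_measure G) (points G)"
    unfolding em
    by (rule nn_integral_ge_point[OF e, of "\<lambda>e. ennreal (cond G e) * emeasure lebesgue (edge_slice G (points G) e)"])
  finally show ?thesis by simp
qed

text \<open>For L^p the point is that the measure is not zero, since there is an edge; for the
  sup-norms one point suffices.\<close>

lemma snorm_pos:
  assumes X: "X \<in> {Lp p |p. 1 \<le> p} \<union> {C0, BUC}"
    and f: "f \<in> carr G X" and nz: "\<And>x. x \<in> points G \<Longrightarrow> f x \<noteq> 0"
  shows "0 < snorm G X f"
proof -
  consider p where "X = Lp p" "1 \<le> p" | "X \<in> {C0, BUC}" using X by auto
  then show ?thesis
  proof cases
    case 1
    let ?M = "graph_measure G"
    have int: "integrable ?M (\<lambda>x. cmod (f x) powr p)" using f 1 by auto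
    have "(\<integral>x. cmod (f x) powr p \<partial>?M) \<noteq> 0"
    proof
      assume "(\<integral>x. cmod (f x) powr p \<partial>?M) = 0"
      then have "AE x in ?M. cmod (f x) powr p = 0"
        using integral_nonneg_eq_0_iff_AE[OF int] by simp
      moreover have "AE x in ?M. cmod (f x) powr p \<noteq> 0" using nz by (intro AE_I2) simp
      ultimately have "AE x in ?M. False" by eventually_elim simp
      then have "emeasure ?M (space ?M) = 0" by (simp only: eventually_False ae_filter_eq_bot_iff)
      then show False using emeasure_points_pos by simp
    qed
    then show ?thesis using 1 by simp
  next
    case 2
    obtain x where x: "x \<in> points G" using points_nonempty by blast
    have "cmod (f x) \<le> (SUP x\<in>points G. cmod (f x))" by (rule cSUP_upper[OF x bdd_above_carr[OF f 2]])
    then show ?thesis using nz[OF x] 2 by (auto intro: less_le_trans[of 0 "cmod (f x)"])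
  qed
qed

end

context slow_interpolation
begin

lemma interp_in_carr_BUC: "k \<le> m \<Longrightarrow> F k \<in> carr G BUC"
proof -
  assume k: "k \<le> m"
  have "cmod (F k p) \<le> 2" if p: "p \<in> points G" for p
  proof -
    obtain e x where ex: "e \<in> arcs (skel G)" "x \<in> {0..len G e}" "p = edge_pt G e x"
      using points_edge_pt[OF p] by blast
    then show ?thesis
      using interp_le_interp_0[OF p k] interp_0_bounds(2)[OF ex(1,2)] \<psi>_le[of "tail (skel G) e"] by simp
  qed
  then show ?thesis using uniformly_continuous_interp[OF k] by (auto simp: bounded_iff)
qed

text \<open>Measurability for \<open>graph_measure\<close> is tested edge by edge, and on an edge
  the function is a polynomial.\<close>

lemma interp_measurable:
  assumes k: "k \<le> m" shows "F k \<in> borel_measurable (graph_measure G)"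
proof (rule measurableI)
  fix S :: "complex set" assume S: "S \<in> sets borel"
  have "edge_slice G (F k -` S \<inter> points G) e \<in> sets lebesgue" if e: "e \<in> arcs (skel G)" for e
  proof -
    let ?f = "\<lambda>s. of_real ((-1) ^ k * profile G \<eta> \<psi> e (2 * k) s) :: complex"
    have "edge_slice G (F k -` S \<inter> points G) e = {0<..<len G e} \<inter> ?f -` S"
      using e by (auto simp: interp_Inner)
    moreover have "?f \<in> borel_measurable borel"
      by (intro borel_measurable_continuous_onI continuous_intros continuous_on_profile e)
    then have "?f -` S \<in> sets borel" using measurable_sets[of ?f borel borel S] S by simp
    ultimately show ?thesis by (auto intro: sets_completionI_sets)
  qed
  then show "F k -` S \<inter> space (graph_measure G) \<in> sets (graph_measure G)"
    by (auto simp: sets_graph_measure)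
qed simp

context
  fixes v \<epsilon> K
  assumes v: "v \<in> verts (skel G)" and \<epsilon>: "0 < \<epsilon>" and \<psi>_def: "\<psi> = (\<lambda>w. exp (- \<epsilon> * vdist G v w))"
    and growth: "\<And>\<epsilon>. 0 < \<epsilon> \<Longrightarrow> ((\<lambda>r. real (edges_in_ball G v r) * exp (- \<epsilon> * r)) \<longlongrightarrow> 0) at_top"
    and cond: "\<And>e. e \<in> arcs (skel G) \<Longrightarrow> cond G e \<le> K"
begin

lemma interp_in_carr_C0: "k \<le> m \<Longrightarrow> F k \<in> carr G C0"
proof -
  assume k: "k \<le> m"
  have "\<exists>S. compactin (mtopology_of (path_metric G)) S \<and> (\<forall>x\<in>points G - S. cmod (F k x) < a)"
    if a: "0 < a" for a
  proof -
    \<comment> \<open>The threshold is where \<open>\<psi>\<close> drops to \<open>a / 2\<close>;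
      beyond it \<open>F 0\<close>, being at most twice \<open>\<psi>\<close> at the tail, is below
      \<open>a\<close>.\<close>
    define E where "E = {e \<in> arcs (skel G). vdist G v (tail (skel G) e) \<le> - ln (a / 2) / \<epsilon>}"
    have "compactin (mtopology_of (path_metric G)) (\<Union>e\<in>E. edge_pt G e ` {0..len G e})"
      using finite_edges_vdist_le[OF v] compactin_edge unfolding E_def by (intro compactin_Union) auto
    moreover have "cmod (F k p) < a" if p: "p \<in> points G - (\<Union>e\<in>E. edge_pt G e ` {0..len G e})" for p
    proof -
      obtain e x where ex: "e \<in> arcs (skel G)" "x \<in> {0..len G e}" "p = edge_pt G e x"
        using points_edge_pt[of p] p by blast
      with p have "e \<notin> E" by auto
      then have "- ln (a / 2) / \<epsilon> < vdist G v (tail (skel G) e)" using ex(1) by (simp add: E_def)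
      then have "- ln (a / 2) < \<epsilon> * vdist G v (tail (skel G) e)"
        by (simp only: pos_divide_less_eq[OF \<epsilon>] mult.commute)
      then have "\<psi> (tail (skel G) e) < exp (ln (a / 2))" unfolding \<psi>_def by simp
      then have "\<psi> (tail (skel G) e) < a / 2" using a by simp
      then show ?thesis
        using interp_le_interp_0[of p k] interp_0_bounds(2)[OF ex(1,2)] p k ex(3) by simp
    qed
    ultimately show ?thesis by blast
  qed
  then show ?thesis using continuous_interp[OF k] by simp
qed

text \<open>The p-th power is at most \<open>2 powr p\<close> times that of \<open>\<psi>\<close> at
  the tail, which decays at rate \<open>\<epsilon> * p\<close>.\<close>

lemma interp_in_carr_Lp:
  assumes p: "1 \<le> p" and k: "k \<le> m" shows "F k \<in> carr G (Lp p)"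
proof -
  have [measurable]: "F k \<in> borel_measurable (graph_measure G)" by (rule interp_measurable[OF k])
  have le: "cmod (F k q) powr p \<le> 2 powr p * exp (- (\<epsilon> * p) * vdist G v (tail (skel G) e))"
    if e: "e \<in> arcs (skel G)" "x \<in> {0..len G e}" "q = edge_pt G e x" for q e x
  proof -
    have q: "q \<in> points G" using edge_pt_in_points e by simp
    have "cmod (F k q) powr p \<le> (2 * \<psi> (tail (skel G) e)) powr p"
      using interp_le_interp_0[OF q k] interp_0_bounds(2)[OF e(1,2)] e(3) p by (intro powr_mono2) auto
    then show ?thesis by (simp add: powr_mult \<psi>_def exp_powr_real mult_ac)
  qed
  have "(\<integral>\<^sup>+q. ennreal (cmod (F k q) powr p) \<partial>graph_measure G) < \<infinity>"
  proof (rule nn_integral_exp_decay_finite[OF v _ _ growth cond])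
    show "0 < \<epsilon> * p" "0 \<le> (2::real) powr p" using \<epsilon> p by auto
    fix w assume "w \<in> verts (skel G)"
    then obtain e x where e: "e \<in> arcs (skel G)" "x \<in> {0..len G e}" "Vertex w = edge_pt G e x"
      using points_edge_pt[of "Vertex w"] by auto
    have "2 powr p * exp (- (\<epsilon> * p) * vdist G v (tail (skel G) e)) \<le> 2 powr p * 1"
      using \<epsilon> p path_dist_nonneg by (intro mult_left_mono) auto
    then show "cmod (F k (Vertex w)) powr p \<le> 2 powr p" using le[OF e] by linarith
  next
    fix e x assume "e \<in> arcs (skel G)" "0 < x" "x < len G e"
    then show "cmod (F k (Inner e x)) powr p \<le> 2 powr p * exp (- (\<epsilon> * p) * vdist G v (tail (skel G) e))"
      using le[of e x "Inner e x"] by (simp add: edge_pt_def)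
  qed
  then have "integrable (graph_measure G) (\<lambda>q. cmod (F k q) powr p)"
    by (intro integrableI_nonneg) auto
  then show ?thesis by simp
qed

lemma interp_in_carr:
  assumes "X \<in> {Lp p |p. 1 \<le> p} \<union> {C0, BUC}" "k \<le> m" shows "F k \<in> carr G X"
  using assms interp_in_carr_C0 interp_in_carr_BUC interp_in_carr_Lp by blast

lemma poly_laplacian_almost_singular:
  assumes X: "X \<in> {Lp p |p. 1 \<le> p} \<union> {C0, BUC}" and m: "1 \<le> m"
  shows "\<exists>f g. (f, g) \<in> poly_laplacian G X m \<and> 0 < snorm G X f \<and> snorm G X g \<le> 2 * C * \<kappa> * snorm G X f"
proof (intro exI conjI)
  interpret S: complete_seminorm "carr G X" "snorm G X" by (rule complete_seminorm_carr[OF X])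
  have carr: "F k \<in> carr G X" "(\<lambda>x. - F k x) \<in> carr G X" if "k \<le> m" for k
    using interp_in_carr[OF X that] S.scale_closed[of "F k" "-1"] by simp_all
  show "(F 0, \<lambda>x. - F m x) \<in> poly_laplacian G X m" by (rule interp_in_poly_laplacian[OF carr])
  show "0 < snorm G X (F 0)" by (rule snorm_pos[OF X carr(1)]) (use interp_0_nonzero in auto)
  show "snorm G X (\<lambda>x. - F m x) \<le> 2 * C * \<kappa> * snorm G X (F 0)"
    using interp_bound[of _ m] m C_pos \<kappa>_nonneg by (intro snorm_le[OF X carr(2) carr(1)]) auto
qed

end

end

section \<open>The exponential weight and the contradiction\<close>

context metric_graph
begin

text \<open>The distance from \<open>v\<close> changes by at most the edge length, so the ratio of
  the two values is \<open>exp t\<close> with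
  \<open>\<bar>t\<bar> \<le> \<epsilon> * u\<close>.\<close>

lemma vdist_exp_slow:
  assumes v: "v \<in> verts (skel G)" and e: "e \<in> arcs (skel G)" and \<epsilon>: "0 \<le> \<epsilon>" and u: "len G e \<le> u"
  shows "\<bar>exp (- \<epsilon> * vdist G v (head (skel G) e)) - exp (- \<epsilon> * vdist G v (tail (skel G) e))\<bar>
    \<le> (exp (\<epsilon> * u) - 1) * exp (- \<epsilon> * vdist G v (tail (skel G) e))"
proof -
  define t where "t = - \<epsilon> * (vdist G v (head (skel G) e) - vdist G v (tail (skel G) e))"
  have "\<bar>t\<bar> \<le> \<epsilon> * u"
    using vdist_edge_diff[OF e v] u \<epsilon> by (simp add: t_def abs_mult mult_left_mono)
  then have t: "exp t \<le> exp (\<epsilon> * u)" "exp (- (\<epsilon> * u)) \<le> exp t" by auto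
  \<comment> \<open>This handles negative \<open>t\<close>: it says that
    \<open>1 - exp (- x) \<le> exp x - 1\<close>.\<close>
  have "2 \<le> exp (\<epsilon> * u) + exp (- (\<epsilon> * u))"
    using cosh_real_ge_1[of "\<epsilon> * u"] by (simp add: cosh_def)
  with t have "\<bar>exp t - 1\<bar> \<le> exp (\<epsilon> * u) - 1" by linarith
  then have "\<bar>exp t - 1\<bar> * exp (- \<epsilon> * vdist G v (tail (skel G) e))
      \<le> (exp (\<epsilon> * u) - 1) * exp (- \<epsilon> * vdist G v (tail (skel G) e))" by (rule mult_right_mono) simp
  also have "\<bar>exp t - 1\<bar> * exp (- \<epsilon> * vdist G v (tail (skel G) e))
      = \<bar>exp (t + - \<epsilon> * vdist G v (tail (skel G) e)) - exp (- \<epsilon> * vdist G v (tail (skel G) e))\<bar>"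
    unfolding exp_add by (subst abs_exp_cancel[symmetric], subst abs_mult[symmetric])
      (simp only: left_diff_distrib mult_1)
  also have "t + - \<epsilon> * vdist G v (tail (skel G) e) = - \<epsilon> * vdist G v (head (skel G) e)"
    by (simp add: t_def algebra_simps)
  finally show ?thesis .
qed

lemma poly_laplacian_not_bounded_below:
  assumes growth: "growth_condition G" and m: "1 \<le> m"
    and X: "X \<in> {Lp p |p. 1 \<le> p} \<union> {C0, BUC}" and \<delta>: "0 < \<delta>"
  shows "\<exists>f g. (f, g) \<in> poly_laplacian G X m \<and> 0 < snorm G X f \<and> snorm G X g \<le> \<delta> * snorm G X f"
proof -
  obtain v K where v: "v \<in> verts (skel G)" and K: "\<And>e. e \<in> arcs (skel G) \<Longrightarrow> cond G e \<le> K"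
    and gr: "\<And>\<epsilon>. 0 < \<epsilon> \<Longrightarrow> ((\<lambda>r. real (edges_in_ball G v r) * exp (- \<epsilon> * r)) \<longlongrightarrow> 0) at_top"
    using growth unfolding growth_condition_def by blast
  obtain u where u: "\<And>e. e \<in> arcs (skel G) \<Longrightarrow> len G e \<le> u" using len_bounds by blast
  obtain e0 where e0: "e0 \<in> arcs (skel G)" using has_edge by blast
  have u0: "0 < u" using u[OF e0] len_pos[OF e0] by simp
  obtain \<eta> :: "real poly" where \<eta>: "poly \<eta> 0 = 0" "poly \<eta> 1 = 1" "\<And>j. 1 \<le> j \<Longrightarrow> j \<le> Suc (2 * m) \<Longrightarrow>
      poly ((pderiv ^^ j) \<eta>) 0 = 0 \<and> poly ((pderiv ^^ j) \<eta>) 1 = 0"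
    using ex_flat_step_poly[of "Suc (2 * m)"] by blast
  obtain C where C: "0 < C" "\<And>e j x. e \<in> arcs (skel G) \<Longrightarrow> j \<le> Suc (2 * m) \<Longrightarrow> x \<in> {0..len G e} \<Longrightarrow>
      \<bar>poly ((pderiv ^^ j) \<eta>) (x / len G e) / len G e ^ j\<bar> \<le> C"
    using ex_profile_bound[of "Suc (2 * m)" \<eta>] by blast
  \<comment> \<open>Chosen so that \<open>2 * C * \<kappa> = min 1 \<delta>\<close>: the bound by 1
    is the requirement of the locale, the bound by \<open>\<delta>\<close> the one of the claim.
    Then \<open>\<epsilon>\<close> solves
    \<open>exp (\<epsilon> * u) - 1 = \<kappa>\<close>.\<close>
  define \<kappa> where "\<kappa> = min 1 \<delta> / (2 * C)"
  define \<epsilon> where "\<epsilon> = ln (1 + \<kappa>) / u"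
  have small: "0 < \<kappa>" "2 * C * \<kappa> = min 1 \<delta>" using C(1) \<delta> by (auto simp: \<kappa>_def)
  have \<epsilon>: "0 < \<epsilon>" "exp (\<epsilon> * u) - 1 = \<kappa>" using small(1) u0 by (auto simp: \<epsilon>_def)
  define \<psi> where "\<psi> = (\<lambda>w. exp (- \<epsilon> * vdist G v w))"
  interpret slow_interpolation G \<eta> \<psi> m C \<kappa>
  proof
    fix e assume e: "e \<in> arcs (skel G)"
    show "\<bar>\<psi> (head (skel G) e) - \<psi> (tail (skel G) e)\<bar> \<le> \<kappa> * \<psi> (tail (skel G) e)"
      using vdist_exp_slow[OF v e _ u[OF e], of \<epsilon>] \<epsilon> by (simp add: \<psi>_def)
  qed (use \<eta> C small \<epsilon>(1) path_dist_nonneg in \<open>auto simp: \<psi>_def\<close>)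
  obtain f g where fg: "(f, g) \<in> poly_laplacian G X m" "0 < snorm G X f"
    "snorm G X g \<le> 2 * C * \<kappa> * snorm G X f"
    using poly_laplacian_almost_singular[OF v \<epsilon>(1) \<psi>_def gr K X m] by blast
  have "2 * C * \<kappa> * snorm G X f \<le> \<delta> * snorm G X f"
    using small(2) fg(2) by (intro mult_right_mono) auto
  with fg show ?thesis by (intro exI[of _ f] exI[of _ g]) linarith
qed

end

theorem corollary5p7:
  fixes G :: "('v, 'e) mgraph" and m :: nat and X :: fun_space
    and T :: "real \<Rightarrow> (('v, 'e) gpoint \<Rightarrow> complex) \<Rightarrow> (('v, 'e) gpoint \<Rightarrow> complex)"
  assumes "metric_graph G"
    and "growth_condition G"
    and "m \<ge> 1"
    and "X \<in> {Lp p |p. 1 \<le> p} \<union> {C0, BUC}"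
    and "C0_semigroup (carr G X) (snorm G X) T"
    and "generator (carr G X) (snorm G X) T = poly_laplacian G X m"
  shows "\<not> uniformly_stable (carr G X) (snorm G X) T"
proof
  assume st: "uniformly_stable (carr G X) (snorm G X) T"
  interpret metric_graph G by fact
  interpret S: complete_seminorm "carr G X" "snorm G X" by (rule complete_seminorm_carr[OF assms(4)])
  obtain C where C: "0 \<le> C"
    "\<And>f g. (f, g) \<in> poly_laplacian G X m \<Longrightarrow> snorm G X f \<le> C * snorm G X g"
    using S.uniformly_stable_generator_bounded_below[OF assms(5) st] unfolding assms(6) by blast
  \<comment> \<open>With \<open>C + 1\<close> in place of \<open>C\<close> the case
    \<open>C = 0\<close> is included and the final factor \<open>C / (C + 1)\<close> is strictly
    below 1.\<close>
  have "0 < 1 / (C + 1)" using C(1) by simp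
  from poly_laplacian_not_bounded_below[OF assms(2,3,4) this] obtain f g where
    fg: "(f, g) \<in> poly_laplacian G X m" "0 < snorm G X f" "snorm G X g \<le> 1 / (C + 1) * snorm G X f"
    by blast
  have "snorm G X f \<le> C * (1 / (C + 1) * snorm G X f)"
    using C(2)[OF fg(1)] mult_left_mono[OF fg(3) C(1)] by linarith
  also have "\<dots> = C / (C + 1) * snorm G X f" by simp
  also have "\<dots> < 1 * snorm G X f" using C(1) fg(2) by (intro mult_strict_right_mono) auto
  finally show False by simp
qed

end
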